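(* Let $p$ be a prime, let $a$ be a positive integer, let $d\in\{0,1,\ldots,p^a\}$, and let $m,n$ be nonnegative integers with $m\ge n$. Let $S_d=\sum_{0<k<d}\frac{(-1)^{k-1}}{k}\left(\frac{d-k}{3}\right)$. Then $$\begin{aligned}&\frac{n+1}{\binom mn}\sum_{k=0}^{p^a-1}\binom{p^am+2k}{p^an+k+d}-(n+1)\left(\frac{p^a-d}{3}\right)-(m-n)\left(\frac d3\right)\\ \equiv\ &\bigl((m-n)^2+(m+1)(n+2)\bigr)p^aS_d-[p=3]\left(\frac d3\right)p(n+1)(m+n+1)\\ &+[p=2\ \text{and}\ 3\nmid d-(-1)^a]\,pm(n+1)\pmod{p^2}.\end{aligned}$$ In particular, with $C_n=\frac1{n+1}\binom{2n}{n}$ the $n$-th Catalan number, $$\frac1{C_n}\sum_{k=0}^{p^a-1}\binom{2p^an+2k}{p^an+k+d}-n\left(\frac d3\right)-(n+1)\left(\frac{p^a-d}{3}\right)\equiv p^a(n+1)(3n+2)S_d-[p=3]\,p(n+1)\left(\frac d3\right)\pmod{p^2}.$$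
   Context: For an integer $x$, $\left(\frac{x}{3}\right)\in\{0,1,-1\}$ denotes the Legendre symbol modulo 3, i.e. the unique element of $\{0,\pm1\}$ congruent to $x$ modulo 3. For an assertion $A$, $[A]$ equals $1$ if $A$ holds and $0$ otherwise. $\binom{n}{k}=0$ if $k>n$ or $k<0$. For rational numbers $x,y$, $x\equiv y\pmod{p^m}$ means that $(x-y)/p^m$ is a rational number whose denominator is not divisible by $p$. *)

theory Defs
  imports "HOL-Number_Theory.Number_Theory"
begin

lemma Legendre_3_unique:
  "s = Legendre x 3 \<longleftrightarrow> s \<in> {0, 1, -1} \<and> [s = x] (mod 3)"
proof -
  have no: "\<not> [y\<^sup>2 = 2] (mod 3)" for y :: int
  proof -
    have "y mod 3 = 0 \<or> y mod 3 = 1 \<or> y mod 3 = 2" by presburger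
    moreover have "y\<^sup>2 mod 3 = (y mod 3)\<^sup>2 mod 3" by (simp add: power_mod)
    ultimately show ?thesis by (auto simp: cong_def)
  qed
  have "x mod 3 = 0 \<or> x mod 3 = 1 \<or> x mod 3 = 2" by presburger
  then consider "x mod 3 = 0" | "x mod 3 = 1" | "x mod 3 = 2" by blast
  then show ?thesis
  proof cases
    case 1
    then show ?thesis by (auto simp: Legendre_def cong_def)
  next
    case 2
    then have "QuadRes 3 x"
      unfolding QuadRes_def cong_def by (intro exI[of _ 1]) simp
    with 2 show ?thesis by (auto simp: Legendre_def cong_def)
  next
    case 3
    then have "\<not> QuadRes 3 x"
      using no unfolding QuadRes_def cong_def by simp
    with 3 show ?thesis by (auto simp: Legendre_def cong_def)
  qed
qed

abbreviation leg3 :: "int \<Rightarrow> rat"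
  where "leg3 x \<equiv> of_int (Legendre x 3)"

text \<open>
  \<open>rat_cong p r x y\<close> is the congruence of rational numbers modulo \<open>p ^ r\<close>; \<^const>\<open>quotient_of\<close>
  returns the numerator and the positive denominator in lowest terms.
\<close>

definition rat_cong :: "nat \<Rightarrow> nat \<Rightarrow> rat \<Rightarrow> rat \<Rightarrow> bool"
  where "rat_cong p r x y \<longleftrightarrow> \<not> int p dvd snd (quotient_of ((x - y) / of_nat (p ^ r)))"

definition S :: "nat \<Rightarrow> rat"
  where "S d = (\<Sum>k\<in>{0<..<d}. (- 1) ^ (k - 1) / of_nat k * leg3 (int d - int k))"

definition catalan :: "nat \<Rightarrow> rat"
  where "catalan n = 1 / of_nat (n + 1) * of_nat ((2 * n) choose n)"

end

theory Submission
  imports Defs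
begin

text \<open>
  Let \<open>q = p ^ a\<close>. By Vandermonde's identity the sum over \<open>k\<close> is
  \<open>\<Sum>s. C(q m, q n + s) W(d - s)\<close> with \<open>W(e) = \<Sum>k<q. C(2k, k + e)\<close>, where only \<open>-q < s < 2q\<close> matters.
  The three-term relation of the Legendre symbol modulo 3 makes \<open>W\<close> telescope:
  \<open>W(e) = \<Sum>i<q-e. C(2q, i) ((q-e-i)/3)\<close> for \<open>0 \<le> e\<close>, and \<open>W\<close> is even. Working with \<open>s\<close> within
  distance \<open>q\<close> of \<open>0\<close> or \<open>q\<close> makes it possible to divide by \<open>C(m, n)\<close>: modulo \<open>p\<^sup>2\<close>,
  \<open>C(q m, q n + s) / C(m, n)\<close> is \<open>(m - n) (-1)^(s-1) q / s\<close> for \<open>0 < s < q\<close>, the other ranges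
  of \<open>s\<close> reduce to this one, and the values at \<open>s = 0\<close> and \<open>s = q\<close> are those of
  \<open>C(m, n)\<close> and \<open>C(m, n + 1)\<close> up to an error that the factors \<open>n + 1\<close> and \<open>m - n\<close> kill.
  This expresses the left-hand side by \<open>q S d\<close>, \<open>q S (q - d)\<close> and a third sum of the same kind. Both
  are compared with \<open>q S d\<close> through \<open>(-1)^(k-1) q / k \<equiv> C(q, k)\<close> and the closed form
  \<open>\<Sum>k. C(N, k) ((x - k)/3) = (-1)^N ((x + N)/3)\<close>; the leftovers are the terms for \<open>p = 2\<close> and \<open>p = 3\<close>.
\<close>

section \<open>The Legendre symbol modulo 3\<close>

lemma Legendre_3_eq: "Legendre x 3 = (x + 1) mod 3 - 1"
proof -
  have "0 \<le> (x + 1) mod 3" "(x + 1) mod 3 < 3" by simp_all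
  then have "(x + 1) mod 3 - 1 \<in> {0, 1, -1}" by auto
  moreover have "[(x + 1) mod 3 - 1 = x] (mod 3)" by (simp add: cong_def mod_diff_left_eq)
  ultimately show ?thesis using Legendre_3_unique by metis
qed

lemma Legendre_3_minus: "Legendre (- x) 3 = - Legendre x 3"
  unfolding Legendre_3_eq by presburger

lemma Legendre_3_sum_consecutive: "Legendre (x + 1) 3 + Legendre x 3 + Legendre (x - 1) 3 = 0"
proof -
  have "x mod 3 = 0 \<or> x mod 3 = 1 \<or> x mod 3 = 2" by presburger
  then show ?thesis
    by (auto simp: Legendre_3_eq; presburger)
qed

lemma Legendre_3_add_multiple: "Legendre (x + 3 * k) 3 = Legendre x 3"
proof -
  have "(x + 3 * k + 1) mod 3 = (x + 1) mod 3"
    using mod_mult_self2[of "x + 1" 3 k] by (simp add: algebra_simps)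
  then show ?thesis by (simp add: Legendre_3_eq)
qed

text \<open>If 3 does not divide \<open>y\<close>, the three arguments run through all residue
  classes modulo 3 and the values cancel; otherwise all lie in the class of
  \<open>x\<close>.\<close>

lemma Legendre_3_sum_shift:
  "Legendre (x + y) 3 + Legendre x 3 + Legendre (x - y) 3 = of_bool (3 dvd y) * 3 * Legendre x 3"
proof -
  define k where "k = y div 3"
  have y: "y = y mod 3 + 3 * k" unfolding k_def by simp
  have shift: "Legendre (x + y) 3 = Legendre (x + y mod 3) 3"
    "Legendre (x - y) 3 = Legendre (x - y mod 3) 3"
    using Legendre_3_add_multiple[of "x + y mod 3" k] Legendre_3_add_multiple[of "x - y mod 3" "- k"] y
    by (metis add.assoc, smt (verit))
  have "y mod 3 = 0 \<or> y mod 3 = 1 \<or> y mod 3 = 2" by presburger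
  then consider "y mod 3 = 0" | "y mod 3 = 1" | "y mod 3 = 2" by blast
  then show ?thesis
  proof cases
    case 1
    then show ?thesis unfolding shift by (simp add: dvd_eq_mod_eq_0)
  next
    case 2
    then show ?thesis unfolding shift
      using Legendre_3_sum_consecutive[of x] by (simp add: dvd_eq_mod_eq_0)
  next
    case 3
    have "Legendre (x + 2) 3 = Legendre (x - 1) 3" "Legendre (x - 2) 3 = Legendre (x + 1) 3"
      using Legendre_3_add_multiple[of "x - 1" 1] Legendre_3_add_multiple[of "x - 2" 1]
      by (simp_all add: add.commute)
    with 3 show ?thesis unfolding shift
      using Legendre_3_sum_consecutive[of x] by (simp add: dvd_eq_mod_eq_0)
  qed
qed

text \<open>Pascal's rule reduces \<open>Suc N\<close> at \<open>x\<close> to \<open>N\<close> at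
  \<open>x\<close> and at \<open>x - 1\<close>; the three-term relation merges the two resulting
  symbols into one of opposite sign.\<close>

lemma sum_choose_Legendre_3:
  "(\<Sum>k\<le>N. int (N choose k) * Legendre (x - int k) 3) = (- 1) ^ N * Legendre (x + int N) 3"
proof (induction N arbitrary: x)
  case 0
  then show ?case by simp
next
  case (Suc N)
  let ?f = "\<lambda>k. Legendre (x - int k) 3"
  have "(\<Sum>k\<le>Suc N. int (Suc N choose k) * ?f k)
      = ?f 0 + (\<Sum>k\<le>N. int (Suc N choose Suc k) * ?f (Suc k))"
    by (subst sum.atMost_Suc_shift) simp
  also have "\<dots> = ?f 0 + (\<Sum>k\<le>N. int (N choose Suc k) * ?f (Suc k))
      + (\<Sum>k\<le>N. int (N choose k) * ?f (Suc k))"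
    by (simp add: sum.distrib algebra_simps)
  also have "?f 0 + (\<Sum>k\<le>N. int (N choose Suc k) * ?f (Suc k)) = (\<Sum>k\<le>Suc N. int (N choose k) * ?f k)"
    by (subst sum.atMost_Suc_shift) simp
  also have "\<dots> = (\<Sum>k\<le>N. int (N choose k) * ?f k)" by simp
  also have "(\<Sum>k\<le>N. int (N choose k) * ?f (Suc k)) = (\<Sum>k\<le>N. int (N choose k) * Legendre ((x - 1) - int k) 3)"
    by (simp add: algebra_simps)
  finally have "(\<Sum>k\<le>Suc N. int (Suc N choose k) * ?f k)
      = (- 1) ^ N * (Legendre (x + int N) 3 + Legendre (x + int N - 1) 3)"
    using Suc.IH[of x] Suc.IH[of "x - 1"] by (simp add: algebra_simps)
  also have "Legendre (x + int N) 3 + Legendre (x + int N - 1) 3 = - Legendre (x + int (Suc N)) 3"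
    using Legendre_3_sum_consecutive[of "x + int N"] by (simp add: algebra_simps)
  finally show ?case by simp
qed

section \<open>Truncated binomial sums weighted by the Legendre symbol\<close>

text \<open>The coefficient of \<open>z ^ l\<close> in
  \<open>(1 + z) ^ M * z / (1 + z + z ^ 2)\<close>, since the symbol modulo 3 has generating
  function \<open>z / (1 + z + z ^ 2)\<close>. The next three lemmas are identities between such
  series.\<close>

definition binomial_leg :: "nat \<Rightarrow> nat \<Rightarrow> int"
  where "binomial_leg M l = (\<Sum>i<l. int (M choose i) * Legendre (int l - int i) 3)"

lemma binomial_leg_Pascal:
  "binomial_leg (Suc M) (Suc l) = binomial_leg M (Suc l) + binomial_leg M l"
proof -
  have "binomial_leg (Suc M) (Suc l) = Legendre (int (Suc l)) 3
     + (\<Sum>i<l. int (Suc M choose Suc i) * Legendre (int l - int i) 3)"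
    unfolding binomial_leg_def by (subst sum.lessThan_Suc_shift) simp
  also have "\<dots> = (Legendre (int (Suc l)) 3 + (\<Sum>i<l. int (M choose Suc i) * Legendre (int l - int i) 3))
     + binomial_leg M l"
    by (simp add: binomial_leg_def sum.distrib algebra_simps)
  also have "Legendre (int (Suc l)) 3 + (\<Sum>i<l. int (M choose Suc i) * Legendre (int l - int i) 3)
     = binomial_leg M (Suc l)"
    unfolding binomial_leg_def by (subst sum.lessThan_Suc_shift) simp
  finally show ?thesis .
qed

text \<open>Multiplying the series by \<open>1 + z + z ^ 2\<close> leaves
  \<open>z * (1 + z) ^ M\<close>. In the sums, the indices below \<open>l\<close> cancel and the
  boundary terms give the right-hand side.\<close>

lemma binomial_leg_three_term:
  "binomial_leg M (Suc (Suc l)) + binomial_leg M (Suc l) + binomial_leg M l = int (M choose Suc l)"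
proof -
  have z: "(\<Sum>i<l. int (M choose i) * Legendre (int (Suc (Suc l)) - int i) 3)
      + (\<Sum>i<l. int (M choose i) * Legendre (int (Suc l) - int i) 3)
      + (\<Sum>i<l. int (M choose i) * Legendre (int l - int i) 3) = 0"
    unfolding sum.distrib[symmetric] distrib_left[symmetric]
    by (rule sum.neutral) (use Legendre_3_sum_consecutive[of "int (Suc l) - int _"] in \<open>auto simp: algebra_simps\<close>)
  show ?thesis
    using z by (simp add: binomial_leg_def Legendre_3_eq algebra_simps)
qed

text \<open>Comes from \<open>(1 + z) ^ 2 = (1 + z + z ^ 2) + z\<close>.\<close>

lemma binomial_leg_telescope:
  "binomial_leg (M + 2) (Suc l) = binomial_leg M l + int (M choose l)"
proof (cases l)
  case 0
  then show ?thesis by (simp add: binomial_leg_def Legendre_3_eq)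
next
  case (Suc l')
  then show ?thesis
    using binomial_leg_three_term[of M l']
    by (simp add: binomial_leg_Pascal)
qed

section \<open>Divisibility in the localization of the integers at a prime\<close>

text \<open>Membership in \<open>p ^ r\<close> times the localization at \<open>p\<close>, with a
  free multiplier \<open>j\<close> in place of a reduced denominator, so that closure under sums and
  products is direct; \<open>r = 0\<close> means \<open>p\<close>-integral.\<close>

definition local_dvd :: "nat \<Rightarrow> nat \<Rightarrow> rat \<Rightarrow> bool"
  where "local_dvd p r x \<longleftrightarrow> (\<exists>i j :: int. \<not> int p dvd j \<and> x * of_int j = of_int (int p ^ r * i))"

locale prime_base =
  fixes p :: nat
  assumes prime_p: "prime p"
begin

abbreviation pd :: "nat \<Rightarrow> rat \<Rightarrow> bool"
  where "pd \<equiv> local_dvd p"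

lemma prime_int_p: "prime (int p)"
  using prime_p by simp

lemma pdI: "\<not> int p dvd j \<Longrightarrow> x * of_int j = of_int (int p ^ r * i) \<Longrightarrow> pd r x"
  unfolding local_dvd_def by blast

lemma pdE:
  assumes "pd r x"
  obtains i j where "\<not> int p dvd j" "x * of_int j = of_int (int p ^ r * i)"
  using assms unfolding local_dvd_def by blast

lemma pd_of_int:
  assumes "int p ^ r dvd i"
  shows "pd r (of_int i)"
proof -
  from assms obtain k where "i = int p ^ r * k" by (rule dvdE)
  moreover have "\<not> int p dvd 1" using prime_int_p not_prime_unit by blast
  ultimately show ?thesis by (intro pdI[of 1 _ _ k]) simp_all
qed

lemma pd_0_of_int [simp]: "pd 0 (of_int i)"
  by (rule pd_of_int) simp

lemma pd_0_of_nat [simp]: "pd 0 (of_nat i)"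
  using pd_0_of_int[of "int i"] by simp

lemma pd_0_1 [simp]: "pd 0 1"
  using pd_0_of_int[of 1] by simp

lemma pd_zero [simp]: "pd r 0"
  using pd_of_int[of r 0] by simp

lemma pd_mult:
  assumes "pd r x" and "pd s y"
  shows "pd (r + s) (x * y)"
proof -
  from assms(1) obtain i j where 1: "\<not> int p dvd j" "x * of_int j = of_int (int p ^ r * i)" by (rule pdE)
  from assms(2) obtain k l where 2: "\<not> int p dvd l" "y * of_int l = of_int (int p ^ s * k)" by (rule pdE)
  have "x * y * of_int (j * l) = (x * of_int j) * (y * of_int l)" by simp
  also have "\<dots> = of_int (int p ^ (r + s) * (i * k))"
    unfolding 1(2) 2(2) by (simp add: power_add)
  finally have "x * y * of_int (j * l) = of_int (int p ^ (r + s) * (i * k))" .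
  moreover have "\<not> int p dvd j * l"
    using 1(1) 2(1) prime_int_p by (simp add: prime_dvd_mult_iff)
  ultimately show ?thesis by (intro pdI)
qed

lemma pd_mult_left: "pd 0 y \<Longrightarrow> pd r x \<Longrightarrow> pd r (y * x)"
  using pd_mult[of 0 y r x] by simp

lemma pd_mult_right: "pd r x \<Longrightarrow> pd 0 y \<Longrightarrow> pd r (x * y)"
  using pd_mult[of r x 0 y] by simp

lemma pd_mult_1_1: "pd 1 x \<Longrightarrow> pd 1 y \<Longrightarrow> pd 2 (x * y)"
  using pd_mult[of 1 x 1 y] by (simp add: numeral_2_eq_2)

lemma pd_add:
  assumes "pd r x" and "pd r y"
  shows "pd r (x + y)"
proof -
  from assms(1) obtain i j where 1: "\<not> int p dvd j" "x * of_int j = of_int (int p ^ r * i)" by (rule pdE)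
  from assms(2) obtain k l where 2: "\<not> int p dvd l" "y * of_int l = of_int (int p ^ r * k)" by (rule pdE)
  have "(x + y) * of_int (j * l) = (x * of_int j) * of_int l + (y * of_int l) * of_int j"
    by (simp add: algebra_simps)
  also have "\<dots> = of_int (int p ^ r * (i * l + k * j))"
    unfolding 1(2) 2(2) by (simp add: algebra_simps)
  finally have "(x + y) * of_int (j * l) = of_int (int p ^ r * (i * l + k * j))" .
  moreover have "\<not> int p dvd j * l"
    using 1(1) 2(1) prime_int_p by (simp add: prime_dvd_mult_iff)
  ultimately show ?thesis by (intro pdI)
qed

lemma pd_minus: "pd r x \<Longrightarrow> pd r (- x)"
  using pd_mult_left[of "of_int (- 1)" r x] pd_0_of_int[of "- 1"] by simp

lemma pd_diff: "pd r x \<Longrightarrow> pd r y \<Longrightarrow> pd r (x - y)"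
  using pd_add[of r x "- y"] pd_minus[of r y] by simp

lemma pd_diff_commute: "pd r (x - y) \<Longrightarrow> pd r (y - x)"
  using pd_minus[of r "x - y"] by simp

lemma pd_trans: "pd r (x - y) \<Longrightarrow> pd r (y - z) \<Longrightarrow> pd r (x - z)"
  using pd_add[of r "x - y" "y - z"] by simp

lemma pd_sum: "(\<And>i. i \<in> A \<Longrightarrow> pd r (f i)) \<Longrightarrow> pd r (\<Sum>i\<in>A. f i)"
  by (induction A rule: infinite_finite_induct) (auto intro: pd_add)

lemma pd_sum_cong: "(\<And>i. i \<in> A \<Longrightarrow> pd r (f i - g i)) \<Longrightarrow> pd r ((\<Sum>i\<in>A. f i) - (\<Sum>i\<in>A. g i))"
  unfolding sum_subtractf[symmetric] by (rule pd_sum)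

lemma pd_mono:
  assumes "pd r x" and "s \<le> r"
  shows "pd s x"
proof -
  from assms(1) obtain i j where 1: "\<not> int p dvd j" "x * of_int j = of_int (int p ^ r * i)" by (rule pdE)
  have "int p ^ r * i = int p ^ s * (int p ^ (r - s) * i)"
    using assms(2) by (simp flip: power_add mult.assoc)
  with 1 show ?thesis by (metis pdI)
qed

lemma pd_mult_cong:
  assumes "pd r (x - x')" and "pd r (y - y')" and "pd 0 x" and "pd 0 y'"
  shows "pd r (x * y - x' * y')"
proof -
  have "x * y - x' * y' = x * (y - y') + (x - x') * y'" by (simp add: algebra_simps)
  moreover have "pd r (x * (y - y'))" using assms(3,2) by (rule pd_mult_left)
  moreover have "pd r ((x - x') * y')" using assms(1,4) by (rule pd_mult_right)
  ultimately show ?thesis by (simp add: pd_add)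
qed

lemma pd_0_of_cong: "pd r (x - y) \<Longrightarrow> pd 0 y \<Longrightarrow> pd 0 x"
  using pd_add[of 0 "x - y" y] pd_mono[of r "x - y" 0] by simp

lemma pd_1_prod:
  assumes "\<And>i. i \<in> A \<Longrightarrow> pd 1 (f i - 1)"
  shows "pd 1 ((\<Prod>i\<in>A. f i) - 1)"
  using assms
proof (induction A rule: infinite_finite_induct)
  case (insert i A)
  have "pd 1 (f i * (\<Prod>i\<in>A. f i) - 1 * 1)"
    using insert by (intro pd_mult_cong) (auto intro: pd_0_of_cong[of 1 _ 1])
  with insert show ?case by simp
qed auto

text \<open>A number congruent to 1 modulo \<open>p\<close> is a unit of the localization: it is
  \<open>(p * k + l) / l\<close> with \<open>l\<close> prime to \<open>p\<close>.\<close>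

lemma pd_cancel_unit:
  assumes "pd r (x * y)" and "pd 1 (y - 1)"
  shows "pd r x"
proof -
  from assms(1) obtain i j where 1: "\<not> int p dvd j" "x * y * of_int j = of_int (int p ^ r * i)" by (rule pdE)
  from assms(2) obtain k l where 2: "\<not> int p dvd l" "(y - 1) * of_int l = of_int (int p ^ 1 * k)" by (rule pdE)
  have y: "y * of_int l = of_int (int p * k + l)"
    using 2(2) by (simp add: algebra_simps)
  have "x * of_int (j * (int p * k + l)) = (x * y * of_int j) * of_int l"
    unfolding of_int_mult y[symmetric] by simp
  also have "\<dots> = of_int (int p ^ r * (i * l))" unfolding 1(2) by simp
  finally have eq: "x * of_int (j * (int p * k + l)) = of_int (int p ^ r * (i * l))" .
  have "\<not> int p dvd int p * k + l"
    using 2(1) by (simp add: dvd_add_right_iff)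
  then have "\<not> int p dvd j * (int p * k + l)"
    using 1(1) prime_int_p by (simp add: prime_dvd_mult_iff)
  then show ?thesis using eq by (rule pdI)
qed

text \<open>The reduced denominator \<open>e\<close> divides the multiplier \<open>j\<close>, hence
  is prime to \<open>p\<close> like \<open>j\<close>.\<close>

lemma rat_cong_if_pd:
  assumes "pd r (x - y)"
  shows "rat_cong p r x y"
proof -
  from assms obtain i j where ij: "\<not> int p dvd j" "(x - y) * of_int j = of_int (int p ^ r * i)" by (rule pdE)
  obtain n e where q: "quotient_of ((x - y) / of_nat (p ^ r)) = (n, e)" by fastforce
  have "p > 0" using prime_p by (simp add: prime_gt_0_nat)
  have e: "e > 0" using q by (rule quotient_of_denom_pos)
  have cop: "coprime n e" using q by (rule quotient_of_coprime)
  have "(x - y) / of_nat (p ^ r) = of_int n / of_int e" using q by (rule quotient_of_div)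
  then have "(x - y) * of_int e = of_int n * of_nat (p ^ r)"
    using e \<open>p > 0\<close> by (simp add: field_simps)
  then have "of_int n * of_nat (p ^ r) * of_int j = ((x - y) * of_int j) * of_int e" by simp
  then have "of_nat (p ^ r) * of_int (n * j) = (of_nat (p ^ r) * of_int (i * e) :: rat)"
    unfolding ij(2) by simp
  then have "(of_int (n * j) :: rat) = of_int (i * e)" using \<open>p > 0\<close> by simp
  then have "n * j = i * e" by (simp only: of_int_eq_iff)
  then have "e dvd n * j" by simp
  with cop have "e dvd j" by (simp add: coprime_commute coprime_dvd_mult_right_iff)
  then show ?thesis using ij(1) q unfolding rat_cong_def by (auto dest: dvd_trans)
qed

end

section \<open>Binomial coefficients with integer lower index\<close>

text \<open>Integer lower indices let symmetry and shifts hold without side conditions that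
  truncated subtraction would impose.\<close>

definition ichoose :: "nat \<Rightarrow> int \<Rightarrow> nat"
  where "ichoose N z = (if z < 0 then 0 else N choose nat z)"

lemma ichoose_of_nat [simp]: "ichoose N (int k) = N choose k"
  by (simp add: ichoose_def)

lemma ichoose_eq_0: "z < 0 \<or> int N < z \<Longrightarrow> ichoose N z = 0"
  by (auto simp: ichoose_def binomial_eq_0)

lemma ichoose_symmetric: "ichoose N (int N - z) = ichoose N z"
proof (cases "0 \<le> z \<and> z \<le> int N")
  case True
  then obtain k where "z = int k" "k \<le> N" by (metis of_nat_le_iff zero_le_imp_eq_int)
  then show ?thesis
    using binomial_symmetric[of k N] by (simp flip: of_nat_diff)
next
  case False
  then show ?thesis by (subst (1 2) ichoose_eq_0) auto
qed

text \<open>By \<open>supp\<close> every term outside \<open>A\<close> vanishes, so one window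
  \<open>A\<close> can serve for several \<open>K\<close> at once.\<close>

lemma ichoose_Vandermonde:
  assumes "finite A" and supp: "\<And>s. 0 \<le> s \<Longrightarrow> 0 \<le> z - s \<Longrightarrow> z - s \<le> int K \<Longrightarrow> s \<in> A"
  shows "(\<Sum>s\<in>A. ichoose M s * ichoose K (z - s)) = ichoose (M + K) z"
proof (cases "z < 0")
  case True
  then have "ichoose M s * ichoose K (z - s) = 0" for s
    using ichoose_eq_0[of s M] ichoose_eq_0[of "z - s" K] by (cases "s < 0") auto
  then have "(\<Sum>s\<in>A. ichoose M s * ichoose K (z - s)) = 0" by (intro sum.neutral ballI)
  with True show ?thesis by (simp add: ichoose_eq_0)
next
  case False
  then obtain l where l: "z = int l" by (metis not_less zero_le_imp_eq_int)
  let ?f = "\<lambda>s. ichoose M s * ichoose K (z - s)"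
  have "sum ?f A = sum ?f (A \<union> int ` {..l})"
  proof (rule sum.mono_neutral_left)
    show "\<forall>s \<in> A \<union> int ` {..l} - A. ?f s = 0"
    proof
      fix s assume "s \<in> A \<union> int ` {..l} - A"
      then have "s < 0 \<or> z - s < 0 \<or> int K < z - s" using supp[of s] by force
      then show "?f s = 0" using ichoose_eq_0[of s M] ichoose_eq_0[of "z - s" K] by auto
    qed
  qed (use assms in auto)
  also have "\<dots> = sum ?f (int ` {..l})"
  proof (rule sum.mono_neutral_right)
    show "\<forall>s \<in> A \<union> int ` {..l} - int ` {..l}. ?f s = 0"
    proof
      fix s assume "s \<in> A \<union> int ` {..l} - int ` {..l}"
      then have "s < 0 \<or> z - s < 0"
        by (metis DiffE atMost_iff image_eqI l linorder_not_less of_nat_le_iff diff_ge_0_iff_ge zero_le_imp_eq_int)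
      then show "?f s = 0" using ichoose_eq_0[of s M] ichoose_eq_0[of "z - s" K] by auto
    qed
  qed (use assms in auto)
  also have "\<dots> = (\<Sum>k\<le>l. (M choose k) * (K choose (l - k)))"
    by (subst sum.reindex) (auto simp: l simp flip: of_nat_diff intro!: sum.cong)
  also have "\<dots> = ichoose (M + K) z" by (simp add: vandermonde l)
  finally show ?thesis .
qed

section \<open>The sums \<open>W(e)\<close> and the Vandermonde expansion\<close>

definition central_sum :: "nat \<Rightarrow> int \<Rightarrow> nat"
  where "central_sum N e = (\<Sum>k<N. ichoose (2 * k) (int k + e))"

lemma central_sum_minus: "central_sum N (- e) = central_sum N e"
proof -
  have "ichoose (2 * k) (int k - e) = ichoose (2 * k) (int k + e)" for k
    using ichoose_symmetric[of "2 * k" "int k + e"] by (simp add: algebra_simps)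
  then show ?thesis by (simp add: central_sum_def)
qed

lemma central_sum_eq_0: "int N \<le> \<bar>e\<bar> \<Longrightarrow> central_sum N e = 0"
  by (auto simp: central_sum_def intro!: ichoose_eq_0)

lemma central_sum_eq: "int (central_sum N (int e)) = binomial_leg (2 * N) (N - e)"
proof -
  \<comment> \<open>The induction runs at \<open>- e\<close>, where the new summand is exactly the
    coefficient added by \<open>binomial_leg_telescope\<close>; evenness then gives the claim at
    \<open>e\<close>.\<close>
  have "int (central_sum N (- int e)) = binomial_leg (2 * N) (N - e)"
  proof (induction N)
    case 0
    then show ?case by (simp add: central_sum_def binomial_leg_def)
  next
    case (Suc N)
    have step: "central_sum (Suc N) (- int e) = central_sum N (- int e) + ichoose (2 * N) (int N - int e)"
      by (simp add: central_sum_def)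
    show ?case
    proof (cases "e \<le> N")
      case True
      then have "ichoose (2 * N) (int N - int e) = 2 * N choose (N - e)"
        by (simp flip: of_nat_diff)
      then show ?thesis
        using Suc binomial_leg_telescope[of "2 * N" "N - e"] True step
        by (simp add: Suc_diff_le)
    next
      case False
      \<comment> \<open>Truncation makes both \<open>N - e\<close> and \<open>Suc N - e\<close>
        equal to 0, and the new summand vanishes.\<close>
      then show ?thesis using Suc step by (simp add: ichoose_eq_0 binomial_leg_def)
    qed
  qed
  then show ?thesis by (simp add: central_sum_minus)
qed

text \<open>Vandermonde splits the upper index as \<open>M\<close> plus \<open>2 * k\<close>. As
  \<open>k < q\<close> and \<open>d \<le> q\<close>, a non-zero second factor forces
  \<open>- q < s < 2 * q\<close>; this window is independent of \<open>k\<close>, so the sums can be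
  exchanged.\<close>

lemma sum_choose_eq_central_sum:
  assumes "d \<le> q"
  shows "(\<Sum>k<q. (M + 2 * k) choose (N + k + d))
    = (\<Sum>s\<in>{- int q<..<2 * int q}. ichoose M (int N + s) * central_sum q (int d - s))"
proof -
  have "(M + 2 * k) choose (N + k + d)
      = (\<Sum>s\<in>{- int q<..<2 * int q}. ichoose M (int N + s) * ichoose (2 * k) (int k + (int d - s)))"
    if "k < q" for k
  proof -
    let ?A = "(\<lambda>s. int N + s) ` {- int q<..<2 * int q}"
    have "(\<Sum>s\<in>?A. ichoose M s * ichoose (2 * k) (int (N + k + d) - s)) = ichoose (M + 2 * k) (int (N + k + d))"
      using that assms by (intro ichoose_Vandermonde) (auto simp: image_iff intro!: bexI[of _ "_ - int N"])
    also have "\<dots> = (M + 2 * k) choose (N + k + d)" by (rule ichoose_of_nat)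
    finally show ?thesis
      by (subst (asm) sum.reindex) (auto simp: algebra_simps)
  qed
  then have "(\<Sum>k<q. (M + 2 * k) choose (N + k + d))
     = (\<Sum>k<q. \<Sum>s\<in>{- int q<..<2 * int q}. ichoose M (int N + s) * ichoose (2 * k) (int k + (int d - s)))"
    by simp
  also have "\<dots> = (\<Sum>s\<in>{- int q<..<2 * int q}. \<Sum>k<q. ichoose M (int N + s) * ichoose (2 * k) (int k + (int d - s)))"
    by (rule sum.swap)
  finally show ?thesis by (simp add: central_sum_def sum_distrib_left)
qed

text \<open>Isolates the multiples 0 and \<open>q\<close> in the window; the other indices are
  \<open>- t\<close>, \<open>t\<close> and \<open>q + t\<close> with \<open>0 < t < q\<close>, a
  range in which \<open>q / t\<close> is divisible by \<open>p\<close> once \<open>q\<close> is a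
  power of \<open>p\<close>.\<close>

lemma sum_int_interval_split:
  fixes f :: "int \<Rightarrow> 'a::comm_monoid_add"
  assumes "q > 0"
  shows "(\<Sum>s\<in>{- int q<..<2 * int q}. f s)
    = (\<Sum>t\<in>{0<..<q}. f (- int t)) + f 0 + (\<Sum>t\<in>{0<..<q}. f (int t)) + f (int q)
      + (\<Sum>t\<in>{0<..<q}. f (int q + int t))"
proof -
  have "(\<Sum>s\<in>{- int q<..<2 * int q}. f s) = sum f {- int q<..<0} + sum f {0..<2 * int q}"
    using assms by (subst sum.union_disjoint[symmetric]) (auto intro!: sum.cong)
  moreover have "sum f {0..<2 * int q} = f 0 + sum f {0<..<2 * int q}"
  proof -
    have "{0..<2 * int q} = insert 0 {0<..<2 * int q}" using assms by auto
    then show ?thesis by simp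
  qed
  moreover have "sum f {0<..<2 * int q} = sum f {0<..<int q} + sum f {int q..<2 * int q}"
    using assms by (subst sum.union_disjoint[symmetric]) (auto intro!: sum.cong)
  moreover have "sum f {int q..<2 * int q} = f (int q) + sum f {int q<..<2 * int q}"
  proof -
    have "{int q..<2 * int q} = insert (int q) {int q<..<2 * int q}" using assms by auto
    then show ?thesis by simp
  qed
  moreover have "sum f {- int q<..<0} = (\<Sum>t\<in>{0<..<q}. f (- int t))"
    by (rule sum.reindex_bij_witness[of _ "\<lambda>t. - int t" "\<lambda>s. nat (- s)"]) auto
  moreover have "sum f {0<..<int q} = (\<Sum>t\<in>{0<..<q}. f (int t))"
    by (rule sum.reindex_bij_witness[of _ int nat]) auto
  moreover have "sum f {int q<..<2 * int q} = (\<Sum>t\<in>{0<..<q}. f (int q + int t))"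
    by (rule sum.reindex_bij_witness[of _ "\<lambda>t. int q + int t" "\<lambda>s. nat (s - int q)"]) auto
  ultimately show ?thesis by (simp add: add.assoc)
qed

section \<open>Ratios of binomial coefficients modulo the square of a prime\<close>

lemma choose_Suc_mult:
  "of_nat (n choose Suc k) * of_nat (Suc k) = (of_nat (n choose k) * (of_nat n - of_nat k) :: rat)"
proof (cases "k \<le> n")
  case True
  have "Suc k * (n choose Suc k) = (n - k) * (n choose k)"
    using binomial_absorption[of k n] binomial_absorb_comp[of n k] by simp
  then have "of_nat (Suc k * (n choose Suc k)) = (of_nat ((n - k) * (n choose k)) :: rat)"
    by (simp only:)
  with True show ?thesis by (simp add: of_nat_diff algebra_simps)
qed (simp add: binomial_eq_0)

locale prime_power = prime_base +
  fixes a :: nat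
  assumes a_pos: "a > 0"
begin

definition q :: nat where "q = p ^ a"

text \<open>For \<open>0 < s < q\<close> this is the residue of \<open>q choose s\<close> modulo
  \<open>p ^ 2\<close>.\<close>

definition alt_frac :: "nat \<Rightarrow> rat"
  where "alt_frac s = (- 1) ^ (s - 1) * (of_nat q / of_nat s)"

text \<open>For natural \<open>x\<close> and \<open>s > 0\<close> this equals
  \<open>(q * x + s - 1) choose (s - 1)\<close>; rational \<open>x\<close> allows negative
  shifts.\<close>

definition shift_prod :: "rat \<Rightarrow> nat \<Rightarrow> rat"
  where "shift_prod x s = (\<Prod>j\<in>{0<..<s}. 1 + x * (of_nat q / of_nat j))"

definition frac_sum :: rat
  where "frac_sum = (\<Sum>j\<in>{0<..<q}. of_nat q / of_nat j)"

lemma q_pos: "q > 0"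
  using prime_p by (simp add: q_def prime_gt_0_nat)

text \<open>Since \<open>s < p ^ a\<close>, the exponent of \<open>p\<close> in \<open>s\<close> is
  below \<open>a\<close>, so a factor \<open>p\<close> survives in the quotient.\<close>

lemma pd_frac:
  assumes "0 < s" and "s < q"
  shows "pd 1 (of_nat q / of_nat s)"
proof -
  define v where "v = multiplicity p s"
  have "s \<noteq> 0" "\<not> is_unit p" using assms prime_p not_prime_unit by auto
  then obtain t where s: "s = p ^ v * t" and t: "\<not> p dvd t"
    unfolding v_def by (rule multiplicity_decompose')
  have "v < a"
  proof (rule ccontr)
    assume "\<not> v < a"
    then have "q dvd s" unfolding q_def s by (simp add: le_imp_power_dvd)
    with assms show False by (auto dest: dvd_imp_le)
  qed
  then have "q = p ^ v * (p * p ^ (a - v - 1))"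
    unfolding q_def by (simp flip: power_Suc power_add)
  moreover have "p > 0" "t > 0" using prime_p t by (auto simp: prime_gt_0_nat intro: gr0I)
  ultimately have "of_nat q / of_nat s * of_nat t = (of_nat (p * p ^ (a - v - 1)) :: rat)"
    by (simp add: s)
  then show ?thesis
    using t by (intro pdI[of "int t" _ 1 "int p ^ (a - v - 1)"]) auto
qed

lemma pd_sign: "pd 0 ((- 1) ^ k)"
  using pd_0_of_int[of "(- 1) ^ k"] by simp

lemma pd_alt_frac: "0 < s \<Longrightarrow> s < q \<Longrightarrow> pd 1 (alt_frac s)"
  unfolding alt_frac_def by (intro pd_mult_left pd_frac pd_sign)

lemma pd_frac_sum: "pd 1 frac_sum"
  unfolding frac_sum_def by (intro pd_sum pd_frac) simp_all

text \<open>Pairing \<open>j\<close> with \<open>q - j\<close> turns the sum of two fractions into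
  their product, and both factors are divisible by \<open>p\<close>.\<close>

lemma pd_2_frac_sum: "pd 2 (2 * frac_sum)"
proof -
  have "frac_sum = (\<Sum>j\<in>{0<..<q}. of_nat q / of_nat (q - j))"
    unfolding frac_sum_def
    by (rule sum.reindex_bij_witness[of _ "\<lambda>j. q - j" "\<lambda>j. q - j"]) auto
  then have "2 * frac_sum = (\<Sum>j\<in>{0<..<q}. of_nat q / of_nat j + of_nat q / of_nat (q - j))"
    by (simp add: sum.distrib frac_sum_def)
  also have "\<dots> = (\<Sum>j\<in>{0<..<q}. (of_nat q / of_nat j) * (of_nat q / of_nat (q - j)))"
    by (rule sum.cong) (auto simp: of_nat_diff field_simps)
  also have "pd 2 \<dots>"
    by (intro pd_sum pd_mult_1_1 pd_frac) auto
  finally show ?thesis .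
qed

lemma shift_prod_1 [simp]: "shift_prod x (Suc 0) = 1"
proof -
  have "{0<..<Suc 0} = {}" by auto
  then show ?thesis by (simp add: shift_prod_def)
qed

lemma shift_prod_Suc: "s > 0 \<Longrightarrow> shift_prod x (Suc s) = shift_prod x s * (1 + x * (of_nat q / of_nat s))"
proof -
  assume "s > 0"
  then have "{0<..<Suc s} = insert s {0<..<s}" by auto
  then show ?thesis by (simp add: shift_prod_def mult.commute)
qed

lemma pd_shift_prod:
  assumes "s \<le> q" and "pd 0 x"
  shows "pd 1 (shift_prod x s - 1)"
  unfolding shift_prod_def
proof (rule pd_1_prod)
  fix j assume "j \<in> {0<..<s}"
  then have "pd 1 (x * (of_nat q / of_nat j))"
    using assms by (intro pd_mult_left pd_frac) auto
  then show "pd 1 (1 + x * (of_nat q / of_nat j) - 1)" by simp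
qed

text \<open>Each factor is 1 plus a multiple of \<open>p\<close>, so only the constant and linear
  terms survive modulo \<open>p ^ 2\<close>.\<close>

lemma shift_prod_cong:
  assumes "pd 0 x"
  shows "pd 2 (shift_prod x q - (1 + x * frac_sum))"
proof -
  have "s > 0 \<Longrightarrow> s \<le> q \<Longrightarrow> pd 2 (shift_prod x s - (1 + x * (\<Sum>j\<in>{0<..<s}. of_nat q / of_nat j)))" for s
  proof (induction s rule: nat_induct_non_zero)
    case 1
    have "{0<..<Suc 0} = {}" by auto
    then show ?case by simp
  next
    case (Suc s)
    define h where "h = (\<Sum>j\<in>{0<..<s}. of_nat q / of_nat j :: rat)"
    define t where "t = (of_nat q / of_nat s :: rat)"
    have "{0<..<Suc s} = insert s {0<..<s}" using Suc.hyps by auto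
    then have h: "(\<Sum>j\<in>{0<..<Suc s}. of_nat q / of_nat j) = t + h"
      by (simp add: h_def t_def)
    have "shift_prod x (Suc s) - (1 + x * (t + h)) = (shift_prod x s - (1 + x * h)) + (shift_prod x s - 1) * (x * t)"
      using Suc.hyps by (simp add: shift_prod_Suc algebra_simps flip: t_def)
    moreover have "pd 2 ((shift_prod x s - 1) * (x * t))"
      unfolding t_def using Suc.hyps Suc.prems assms by (intro pd_mult_1_1 pd_shift_prod pd_mult_left pd_frac) auto
    moreover have "pd 2 (shift_prod x s - (1 + x * h))" unfolding h_def using Suc by simp
    ultimately show ?case unfolding h by (simp only: pd_add)
  qed
  then show ?thesis using q_pos by (simp add: frac_sum_def)
qed

section \<open>Binomial coefficients at and near multiples of \<open>q\<close>\<close>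

text \<open>Raising the lower index from \<open>q * N + j\<close> to \<open>q * N + j + 1\<close>
  multiplies by \<open>(q * (M - N) - j) / (q * N + j + 1)\<close>. The step \<open>j = 0\<close>
  supplies \<open>q * (M - N)\<close>; normalizing the other factors by integers yields the sign,
  the \<open>1 / s\<close> and the two shift products.\<close>

lemma choose_shift:
  assumes "s > 0"
  shows "of_nat ((q * M) choose (q * N + s)) * shift_prod (of_nat N) (Suc s)
    = of_nat ((q * M) choose (q * N)) * (of_nat M - of_nat N) * alt_frac s * shift_prod (- (of_nat M - of_nat N)) s"
  using assms
proof (induction s rule: nat_induct_non_zero)
  case 1
  show ?case
    using choose_Suc_mult[of "q * M" "q * N"] by (simp add: shift_prod_Suc alt_frac_def algebra_simps)
next
  case (Suc s)
  let ?x = "of_nat M - of_nat N :: rat"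
  let ?c = "\<lambda>s. of_nat ((q * M) choose (q * N + s)) :: rat"
  have "?c (Suc s) * shift_prod (of_nat N) (Suc (Suc s))
      = (?c (Suc s) * of_nat (Suc (q * N + s))) / of_nat (Suc s) * shift_prod (of_nat N) (Suc s)"
    by (subst shift_prod_Suc) (simp_all add: field_simps)
  also have "?c (Suc s) * of_nat (Suc (q * N + s)) = ?c s * (of_nat q * ?x - of_nat s)"
    using choose_Suc_mult[of "q * M" "q * N + s"] by (simp add: right_diff_distrib diff_diff_eq)
  also have "\<dots> / of_nat (Suc s) * shift_prod (of_nat N) (Suc s)
      = ?c s * shift_prod (of_nat N) (Suc s) * (of_nat q * ?x - of_nat s) / of_nat (Suc s)" by simp
  also have "\<dots> = ?c 0 * ?x * alt_frac s * shift_prod (- ?x) s * (of_nat q * ?x - of_nat s) / of_nat (Suc s)"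
    unfolding Suc.IH by simp
  also have "alt_frac s * shift_prod (- ?x) s * (of_nat q * ?x - of_nat s) / of_nat (Suc s) = alt_frac (Suc s) * shift_prod (- ?x) (Suc s)"
  proof -
    have alt_frac: "alt_frac (Suc s) = - (alt_frac s * of_nat s / of_nat (Suc s))"
      using Suc.hyps by (cases s) (simp_all add: alt_frac_def)
    have "of_nat s * (1 + - ?x * (of_nat q / of_nat s)) = - (of_nat q * ?x - of_nat s)"
      using Suc.hyps by (simp add: field_simps)
    then have "alt_frac (Suc s) * shift_prod (- ?x) (Suc s) = - (alt_frac s * shift_prod (- ?x) s / of_nat (Suc s)) * - (of_nat q * ?x - of_nat s)"
      using Suc.hyps unfolding alt_frac by (simp only: shift_prod_Suc) simp
    then show ?thesis by (simp only: minus_mult_minus times_divide_eq_left)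
  qed
  then have "?c 0 * ?x * alt_frac s * shift_prod (- ?x) s * (of_nat q * ?x - of_nat s) / of_nat (Suc s)
      = ?c 0 * ?x * alt_frac (Suc s) * shift_prod (- ?x) (Suc s)"
    by (metis (no_types, lifting) mult.assoc times_divide_eq_right)
  finally show ?case by simp
qed

text \<open>Each of the \<open>q - 1\<close> factors absorbs one sign, and replacing
  \<open>j\<close> by \<open>q - j\<close> turns the numerators \<open>q * x - j\<close> into
  \<open>q * (x - 1) + j\<close>.\<close>

lemma shift_prod_reflect: "(- 1) ^ (q - 1) * shift_prod (- x) q = shift_prod (x - 1) q"
proof -
  have card: "card {0<..<q} = q - 1" by simp
  have "(- 1) ^ (q - 1) * shift_prod (- x) q = (\<Prod>j\<in>{0<..<q}. - (1 - x * (of_nat q / of_nat j)))"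
    unfolding shift_prod_def card[symmetric] prod_constant[symmetric] prod.distrib[symmetric] by simp
  also have "\<dots> = (\<Prod>j\<in>{0<..<q}. (of_nat q * x - of_nat j) / of_nat j)"
    by (rule prod.cong) (auto simp: field_simps)
  also have "\<dots> = (\<Prod>j\<in>{0<..<q}. of_nat q * x - of_nat j) / (\<Prod>j\<in>{0<..<q}. of_nat j)"
    by (rule prod_dividef)
  also have "(\<Prod>j\<in>{0<..<q}. of_nat q * x - of_nat j) = (\<Prod>j\<in>{0<..<q}. of_nat q * (x - 1) + of_nat j)"
    by (rule prod.reindex_bij_witness[of _ "\<lambda>j. q - j" "\<lambda>j. q - j"])
      (auto simp: of_nat_diff algebra_simps)
  also have "\<dots> / (\<Prod>j\<in>{0<..<q}. of_nat j) = (\<Prod>j\<in>{0<..<q}. (of_nat q * (x - 1) + of_nat j) / of_nat j)"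
    by (rule prod_dividef[symmetric])
  also have "\<dots> = shift_prod (x - 1) q"
    unfolding shift_prod_def by (rule prod.cong) (auto simp: field_simps)
  finally show ?thesis .
qed

definition choose_quot :: "nat \<Rightarrow> nat \<Rightarrow> rat"
  where "choose_quot M N = of_nat ((q * M) choose (q * N)) / of_nat (M choose N)"

text \<open>Compares \<open>choose_shift\<close> at \<open>s = q\<close> with the absorption
  identity for \<open>M choose Suc N\<close>. There the last factor of
  \<open>shift_prod (of_nat N) (Suc q)\<close> is \<open>N + 1\<close>, and
  \<open>alt_frac q\<close> is a sign, absorbed by \<open>shift_prod_reflect\<close>.\<close>

lemma choose_quot_step:
  assumes "N < M"
  shows "choose_quot M (Suc N) * shift_prod (of_nat N) q = choose_quot M N * shift_prod (of_nat M - of_nat N - 1) q"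
proof -
  let ?x = "of_nat M - of_nat N :: rat"
  let ?c = "\<lambda>N. of_nat ((q * M) choose (q * N)) :: rat"
  let ?b = "\<lambda>N. of_nat (M choose N) :: rat"
  have nz: "?b N \<noteq> 0" "?b (Suc N) \<noteq> 0" "?x \<noteq> 0" "(of_nat (Suc N) :: rat) \<noteq> 0"
    using assms by (simp_all del: of_nat_Suc)
  have b: "?b (Suc N) * of_nat (Suc N) = ?b N * ?x"
    by (rule choose_Suc_mult)
  have "?c (Suc N) * shift_prod (of_nat N) q * of_nat (Suc N) = ?c (Suc N) * shift_prod (of_nat N) (Suc q)"
    using q_pos by (simp add: shift_prod_Suc algebra_simps)
  also have "\<dots> = ?c N * ?x * alt_frac q * shift_prod (- ?x) q"
    using choose_shift[OF q_pos, of M N] by (simp add: add.commute)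
  also have "\<dots> = ?c N * shift_prod (?x - 1) q * ?x"
    unfolding shift_prod_reflect[symmetric] using q_pos by (simp add: alt_frac_def)
  finally have c: "?c (Suc N) * shift_prod (of_nat N) q * of_nat (Suc N) = ?c N * shift_prod (?x - 1) q * ?x" .
  have "(choose_quot M (Suc N) * shift_prod (of_nat N) q) * (?b (Suc N) * of_nat (Suc N)) = ?c (Suc N) * shift_prod (of_nat N) q * of_nat (Suc N)"
    using nz unfolding choose_quot_def by simp
  also have "\<dots> = (choose_quot M N * shift_prod (?x - 1) q) * (?b N * ?x)"
    unfolding c using nz unfolding choose_quot_def by simp
  finally show ?thesis
    unfolding b using nz by simp
qed

lemma pd_0_of_int_diff: "pd 0 (of_nat i - of_nat j)"
  by (intro pd_diff pd_0_of_nat)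

lemma pd_2_frac_sum_square: "pd 2 (frac_sum * frac_sum)"
  by (intro pd_mult_1_1 pd_frac_sum)

lemma choose_quot_cong:
  "N \<le> M \<Longrightarrow> pd 2 (choose_quot M N - (1 + frac_sum * of_nat N * (of_nat M - of_nat N)))"
proof (induction N)
  case 0
  then show ?case by (simp add: choose_quot_def)
next
  case (Suc N)
  let ?n = "of_nat N :: rat" and ?x = "of_nat M - of_nat N - 1 :: rat"
  have x: "pd 0 ?x" using pd_0_of_int[of "int M - int N - 1"] by simp
  have frac_sum: "pd 0 frac_sum" using pd_frac_sum by (rule pd_mono) simp
  define G where "G = 1 + frac_sum * ?n * (of_nat M - ?n)"
  have G: "pd 0 G" unfolding G_def using frac_sum by (intro pd_add pd_mult_right pd_0_1 pd_0_of_nat pd_0_of_int_diff)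
  define G' where "G' = 1 + frac_sum * (?n + 1) * ?x"
  have G': "pd 0 G'"
    unfolding G'_def using frac_sum x by (intro pd_add pd_mult_right pd_0_1 pd_0_of_nat)
  have "pd 0 (1 + ?x * frac_sum)" by (intro pd_add pd_mult_left x frac_sum pd_0_1)
  moreover have "pd 0 (shift_prod ?x q)" using pd_shift_prod[OF order_refl x] by (rule pd_0_of_cong) simp
  moreover have "pd 2 (choose_quot M N - G)" using Suc unfolding G_def by simp
  ultimately have "pd 2 (choose_quot M N * shift_prod ?x q - G * (1 + ?x * frac_sum))"
    using shift_prod_cong[OF x] G pd_0_of_cong[of 2 "choose_quot M N" G] by (intro pd_mult_cong)
  moreover have "pd 2 (G' * shift_prod ?n q - G' * (1 + ?n * frac_sum))"
    unfolding right_diff_distrib[symmetric] by (intro pd_mult_left G' shift_prod_cong pd_0_of_nat)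
  \<comment> \<open>The linear terms in \<open>frac_sum\<close> agree because
    \<open>N * (M - N) + (M - N - 1) = (N + 1) * (M - N - 1) + N\<close>; a multiple of its square
    remains.\<close>
  moreover have "pd 2 (G * (1 + ?x * frac_sum) - G' * (1 + ?n * frac_sum))"
  proof -
    have "G * (1 + ?x * frac_sum) - G' * (1 + ?n * frac_sum) = (frac_sum * frac_sum) * (?x * (?n * (of_nat M - ?n)) - (?n + 1) * ?x * ?n)"
      unfolding G_def G'_def by (simp add: algebra_simps)
    moreover have "pd 0 (?x * (?n * (of_nat M - ?n)) - (?n + 1) * ?x * ?n)"
      by (intro pd_diff pd_mult_left pd_mult_right pd_add x pd_0_1 pd_0_of_nat pd_0_of_int_diff)
    ultimately show ?thesis by (simp add: pd_2_frac_sum_square pd_mult_right)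
  qed
  ultimately have "pd 2 (choose_quot M N * shift_prod ?x q - G' * shift_prod ?n q)"
    by (meson pd_trans pd_diff_commute)
  then have "pd 2 ((choose_quot M (Suc N) - G') * shift_prod ?n q)"
    using choose_quot_step[of N M] Suc.prems by (simp add: algebra_simps)
  then have "pd 2 (choose_quot M (Suc N) - G')"
    by (rule pd_cancel_unit) (intro pd_shift_prod pd_0_of_nat order_refl)
  then show ?case unfolding G'_def by (simp add: algebra_simps)
qed

lemma pd_choose_quot:
  assumes "N \<le> M"
  shows "pd 1 (choose_quot M N - 1)"
proof -
  let ?g = "frac_sum * of_nat N * (of_nat M - of_nat N)"
  have "pd 1 (choose_quot M N - (1 + ?g))"
    using choose_quot_cong[OF assms] by (rule pd_mono) simp
  moreover have "pd 1 ?g"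
    by (intro pd_mult_right pd_frac_sum pd_0_of_nat pd_0_of_int_diff)
  ultimately have "pd 1 (choose_quot M N - (1 + ?g) + ?g)" by (rule pd_add)
  then show ?thesis by simp
qed

text \<open>In \<open>choose_shift\<close> the factor \<open>alt_frac s\<close> is already divisible
  by \<open>p\<close>, so the remaining quotient and shift products matter only modulo
  \<open>p\<close>, where they are 1.\<close>

lemma choose_ratio_cong:
  assumes "N \<le> M" and "0 < s" and "s < q"
  shows "pd 2 (of_nat ((q * M) choose (q * N + s)) / of_nat (M choose N) - (of_nat M - of_nat N) * alt_frac s)"
proof -
  let ?x = "of_nat M - of_nat N :: rat"
  let ?c = "of_nat ((q * M) choose (q * N + s)) / of_nat (M choose N) :: rat"
  have nx: "pd 0 (- ?x)" by (intro pd_minus pd_0_of_int_diff)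
  have shift_prod: "pd 1 (shift_prod (of_nat N) (Suc s) - 1)" "pd 1 (shift_prod (- ?x) s - 1)"
    using assms by (intro pd_shift_prod nx pd_0_of_nat; simp)+
  have eq: "?c * shift_prod (of_nat N) (Suc s) = choose_quot M N * ?x * alt_frac s * shift_prod (- ?x) s"
    using choose_shift[OF assms(2), of M N] by (simp add: choose_quot_def)
  have "pd 1 (choose_quot M N * shift_prod (- ?x) s - 1 * 1)"
    using assms shift_prod(2) by (intro pd_mult_cong pd_choose_quot) (auto intro: pd_0_of_cong pd_choose_quot)
  then have "pd 1 (choose_quot M N * shift_prod (- ?x) s - shift_prod (of_nat N) (Suc s))"
    using shift_prod(1) by (auto intro: pd_trans pd_diff_commute)
  then have "pd 2 ((?x * alt_frac s) * (choose_quot M N * shift_prod (- ?x) s - shift_prod (of_nat N) (Suc s)))"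
    using assms by (intro pd_mult_1_1 pd_mult_left pd_alt_frac pd_0_of_int_diff)
  moreover have "(?c - ?x * alt_frac s) * shift_prod (of_nat N) (Suc s) = (?x * alt_frac s) * (choose_quot M N * shift_prod (- ?x) s - shift_prod (of_nat N) (Suc s))"
    unfolding left_diff_distrib[of ?c] eq by (simp add: algebra_simps)
  ultimately have "pd 2 ((?c - ?x * alt_frac s) * shift_prod (of_nat N) (Suc s))" by simp
  then show ?thesis using shift_prod(1) by (rule pd_cancel_unit)
qed

lemma choose_q_cong: "0 < s \<Longrightarrow> s < q \<Longrightarrow> pd 2 (of_nat (q choose s) - alt_frac s)"
  using choose_ratio_cong[of 0 1 s] by simp

lemma choose_2q_cong: "0 < s \<Longrightarrow> s < q \<Longrightarrow> pd 2 (of_nat ((2 * q) choose s) - 2 * alt_frac s)"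
  using choose_ratio_cong[of 0 2 s] by (simp add: mult.commute)

text \<open>Symmetry moves the index to \<open>q * (M - N) + t\<close>, so \<open>N\<close> takes
  the place of \<open>M - N\<close>.\<close>

lemma choose_ratio_lower:
  assumes "N \<le> M" and "0 < t" and "t < q"
  shows "pd 2 (of_nat (ichoose (q * M) (int (q * N) - int t)) / of_nat (M choose N) - of_nat N * alt_frac t)"
proof -
  obtain k where "M = N + k" using assms(1) le_Suc_ex by blast
  then have "int (q * M) - (int (q * N) - int t) = int (q * (M - N) + t)"
    by (simp add: algebra_simps)
  then have "ichoose (q * M) (int (q * N) - int t) = (q * M) choose (q * (M - N) + t)"
    using ichoose_symmetric[of "q * M" "int (q * N) - int t"] by (metis ichoose_of_nat)
  then show ?thesis
    using choose_ratio_cong[of "M - N" M t] assms by (simp add: of_nat_diff flip: binomial_symmetric)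
qed

text \<open>
  For \<open>p = 2\<close> the quotient can be \<open>-1\<close> modulo 4, because then only \<open>2 * frac_sum\<close>, not \<^const>\<open>frac_sum\<close>,
  vanishes modulo \<open>p\<^sup>2\<close>; the factor \<open>n + 1\<close> supplies the missing 2.
\<close>

lemma choose_quot_near:
  assumes "n \<le> m"
  shows "pd 2 (of_nat (n + 1) * (choose_quot m n - 1))"
proof -
  have "pd 2 (of_nat (n + 1) * (choose_quot m n - (1 + frac_sum * of_nat n * (of_nat m - of_nat n))))"
    using assms by (intro pd_mult_left choose_quot_cong pd_0_of_nat)
  moreover have "pd 2 (of_nat (n + 1) * (frac_sum * of_nat n * (of_nat m - of_nat n)))"
  proof -
    obtain k where k: "n * (n + 1) = 2 * k" by (metis even_Suc even_mult_iff dvdE Suc_eq_plus1)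
    have "of_nat (n + 1) * (frac_sum * of_nat n * (of_nat m - of_nat n)) = frac_sum * of_nat (n * (n + 1)) * (of_nat m - of_nat n)"
      by (simp add: algebra_simps)
    also have "\<dots> = 2 * frac_sum * (of_nat k * (of_nat m - of_nat n))" unfolding k by simp
    finally show ?thesis
      by (simp only:) (intro pd_mult_right pd_2_frac_sum pd_mult_left pd_0_of_int_diff pd_0_of_nat)
  qed
  ultimately show ?thesis by (auto dest: pd_add simp: algebra_simps)
qed

text \<open>With \<open>l = m - n - 1\<close>, the outer factor and the one in the error term form
  the even product \<open>l * (l + 1)\<close>, which supplies the 2 for
  \<open>pd_2_frac_sum\<close>.\<close>

lemma choose_quot_near_Suc:
  assumes "n < m"
  shows "pd 2 ((of_nat m - of_nat n) * (choose_quot m (n + 1) - 1))"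
proof -
  let ?x = "of_nat m - of_nat n :: rat"
  have "pd 2 (?x * (choose_quot m (n + 1) - (1 + frac_sum * of_nat (n + 1) * (of_nat m - of_nat (n + 1)))))"
    using assms by (intro pd_mult_left choose_quot_cong pd_0_of_int_diff) auto
  moreover have "pd 2 (?x * (frac_sum * of_nat (n + 1) * (of_nat m - of_nat (n + 1))))"
  proof -
    obtain l where l: "m = Suc (n + l)" using assms less_iff_Suc_add by auto
    obtain k where k: "l * (l + 1) = 2 * k" by (metis even_Suc even_mult_iff dvdE Suc_eq_plus1)
    have "?x * (frac_sum * of_nat (n + 1) * (of_nat m - of_nat (n + 1))) = frac_sum * of_nat (l * (l + 1)) * of_nat (n + 1)"
      by (simp add: l algebra_simps)
    also have "\<dots> = 2 * frac_sum * (of_nat k * of_nat (n + 1))" unfolding k by simp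
    finally show ?thesis
      by (simp only:) (intro pd_mult_right pd_2_frac_sum pd_mult_left pd_0_of_nat)
  qed
  ultimately show ?thesis by (auto dest: pd_add simp: algebra_simps)
qed

section \<open>The normalized sum\<close>

text \<open>The residue of \<^const>\<open>central_sum\<close> modulo \<open>p\<close>.\<close>

definition cut_leg :: "int \<Rightarrow> rat"
  where "cut_leg e = (if \<bar>e\<bar> \<le> int q then leg3 (int q - \<bar>e\<bar>) else 0)"

text \<open>The third sum of the overview, from the range \<open>0 < s < q\<close>; there
  \<open>d - s\<close> can have either sign, hence the absolute value.\<close>

definition reflected_sum :: "nat \<Rightarrow> rat"
  where "reflected_sum d = (\<Sum>t\<in>{0<..<q}. alt_frac t * leg3 (int q - \<bar>int d - int t\<bar>))"

lemma q_times_S: "of_nat q * S n = (\<Sum>k\<in>{0<..<n}. alt_frac k * leg3 (int n - int k))"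
  unfolding S_def sum_distrib_left by (rule sum.cong) (auto simp: alt_frac_def)

lemma pd_q_times_S: "n \<le> q \<Longrightarrow> pd 1 (of_nat q * S n)"
  unfolding q_times_S by (intro pd_sum pd_mult_right pd_alt_frac) auto

text \<open>In the closed form the index 0 gives the symbol, and the others, with
  \<open>2 * q choose i\<close> replaced by \<open>2 * alt_frac i\<close>, give the multiple of
  \<open>S\<close>.\<close>

lemma central_sum_cong:
  assumes "e \<le> q"
  shows "pd 2 (of_nat (central_sum q (int e)) - (leg3 (int q - int e) + 2 * (of_nat q * S (q - e))))"
proof (cases "e = q")
  case True
  have "{0<..<0::nat} = {}" by auto
  with True show ?thesis by (simp add: central_sum_eq_0 S_def Legendre_3_eq)
next
  case False
  define n where "n = q - e"
  have n: "n > 0" "n \<le> q" "int q - int e = int n" using False assms by (auto simp: n_def)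
  have "{..<n} = insert 0 {0<..<n}" using n by auto
  then have "int (central_sum q (int e)) = Legendre (int n) 3
      + (\<Sum>i\<in>{0<..<n}. int (2 * q choose i) * Legendre (int n - int i) 3)"
    by (simp add: central_sum_eq binomial_leg_def n_def)
  then have "(of_int (int (central_sum q (int e))) :: rat) = of_int (Legendre (int n) 3
      + (\<Sum>i\<in>{0<..<n}. int (2 * q choose i) * Legendre (int n - int i) 3))" by (simp only:)
  then have "of_nat (central_sum q (int e)) - (leg3 (int n) + 2 * (of_nat q * S n))
      = (\<Sum>i\<in>{0<..<n}. (of_nat (2 * q choose i) - 2 * alt_frac i) * leg3 (int n - int i))"
    by (simp add: q_times_S sum_subtractf sum_distrib_left left_diff_distrib mult.assoc)
  also have "pd 2 \<dots>"
    using n by (intro pd_sum pd_mult_right choose_2q_cong pd_0_of_int) auto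
  finally show ?thesis unfolding n(3) n_def .
qed

lemma central_sum_cong_1: "pd 1 (of_nat (central_sum q e) - cut_leg e)"
proof (cases "\<bar>e\<bar> \<le> int q")
  case True
  define f where "f = nat \<bar>e\<bar>"
  have f: "\<bar>e\<bar> = int f" "f \<le> q" using True by (auto simp: f_def)
  have c: "central_sum q e = central_sum q (int f)"
    using central_sum_minus[of q e] f(1) by (metis abs_if)
  have "pd 1 (of_nat (central_sum q (int f)) - (leg3 (int q - int f) + 2 * (of_nat q * S (q - f))))"
    using central_sum_cong[OF f(2)] by (rule pd_mono) simp
  moreover have "pd 1 (2 * (of_nat q * S (q - f)))"
    using pd_0_of_int[of 2] by (intro pd_mult_left pd_q_times_S) auto
  ultimately have "pd 1 (of_nat (central_sum q (int f)) - (leg3 (int q - int f) + 2 * (of_nat q * S (q - f)))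
      + 2 * (of_nat q * S (q - f)))" by (rule pd_add)
  then show ?thesis using True by (simp add: cut_leg_def c f)
next
  case False
  then show ?thesis by (simp add: cut_leg_def central_sum_eq_0)
qed

text \<open>As \<open>y'\<close> already carries a factor \<open>p\<close>, the cofactor
  \<open>w\<close> matters only modulo \<open>p\<close>.\<close>

lemma pd_2_mult_cong:
  assumes "pd 2 (y - y')" and "pd 1 y'" and "pd 1 (w - w')" and "pd 0 w"
  shows "pd 2 (y * w - y' * w')"
proof -
  have "y * w - y' * w' = (y - y') * w + y' * (w - w')" by (simp add: algebra_simps)
  then show ?thesis using pd_add[OF pd_mult_right[OF assms(1,4)] pd_mult_1_1[OF assms(2,3)]] by simp
qed

lemma weighted_sum_cong:
  assumes y: "\<And>t. 0 < t \<Longrightarrow> t < q \<Longrightarrow> pd 2 (y t - c * alt_frac t)" and c: "pd 0 c"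
  shows "pd 2 ((\<Sum>t\<in>{0<..<q}. y t * of_nat (central_sum q (e t))) - c * (\<Sum>t\<in>{0<..<q}. alt_frac t * cut_leg (e t)))"
  unfolding sum_distrib_left mult.assoc[symmetric]
  by (intro pd_sum_cong pd_2_mult_cong y central_sum_cong_1 pd_mult_left c pd_alt_frac pd_0_of_nat) auto

text \<open>The cutoff in \<open>cut_leg\<close> restricts the first sum to
  \<open>t \<le> q - d\<close> and the last to \<open>t \<le> d\<close>; at equality the symbol is
  0, matching the strict range in \<open>S\<close>. In the middle sum the cutoff never acts.\<close>

lemma weighted_cut_leg_sums:
  assumes "d \<le> q"
  shows "(\<Sum>t\<in>{0<..<q}. alt_frac t * cut_leg (int d + int t)) = of_nat q * S (q - d)"
    and "(\<Sum>t\<in>{0<..<q}. alt_frac t * cut_leg (int d - int t)) = reflected_sum d"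
    and "(\<Sum>t\<in>{0<..<q}. alt_frac t * cut_leg (int d - (int q + int t))) = of_nat q * S d"
proof -
  show "(\<Sum>t\<in>{0<..<q}. alt_frac t * cut_leg (int d + int t)) = of_nat q * S (q - d)"
    unfolding q_times_S
    by (rule sum.mono_neutral_cong_right)
      (use assms in \<open>auto simp: cut_leg_def of_nat_diff Legendre_3_eq not_less algebra_simps\<close>)
  show "(\<Sum>t\<in>{0<..<q}. alt_frac t * cut_leg (int d - int t)) = reflected_sum d"
    unfolding reflected_sum_def by (rule sum.cong) (use assms in \<open>auto simp: cut_leg_def\<close>)
  show "(\<Sum>t\<in>{0<..<q}. alt_frac t * cut_leg (int d - (int q + int t))) = of_nat q * S d"
    unfolding q_times_S
    by (rule sum.mono_neutral_cong_right)
      (use assms in \<open>auto simp: cut_leg_def Legendre_3_eq not_less algebra_simps\<close>)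
qed

text \<open>The indices \<open>s \<le> 0\<close> contribute \<open>E\<close>, those with
  \<open>s \<ge> q\<close> contribute \<open>D\<close>, and the open range between contributes
  \<open>reflected_sum\<close>; the two symbols come from \<open>s = 0\<close> and
  \<open>s = q\<close>.\<close>

lemma normalized_sum_cong:
  fixes m n d :: nat
  assumes "n \<le> m" and "d \<le> q"
  defines "x \<equiv> of_nat m - of_nat n :: rat" and "D \<equiv> of_nat q * S d" and "E \<equiv> of_nat q * S (q - d)"
  shows "pd 2 (of_nat (n + 1) / of_nat (m choose n) * (\<Sum>k<q. of_nat ((q * m + 2 * k) choose (q * n + k + d)))
    - (of_nat (n + 1) * leg3 (int q - int d) + x * leg3 (int d)
      + of_nat ((n + 1) * (n + 2)) * E + x * (x + 1) * D + of_nat (n + 1) * x * reflected_sum d))"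
proof -
  define b where "b = (of_nat (m choose n) :: rat)"
  define g where "g = of_nat (n + 1) / b"
  define c where "c z = (of_nat (ichoose (q * m) (int (q * n) + z)) :: rat)" for z
  define w where "w e = (of_nat (central_sum q e) :: rat)" for e
  have b: "b \<noteq> 0" using assms(1) by (simp add: b_def)
  have x: "pd 0 x" unfolding x_def by (rule pd_0_of_int_diff)
  have w: "pd 0 (w e)" for e unfolding w_def by simp
  have "(\<Sum>k<q. of_nat ((q * m + 2 * k) choose (q * n + k + d)))
      = (\<Sum>s\<in>{- int q<..<2 * int q}. c s * w (int d - s))"
    using arg_cong[OF sum_choose_eq_central_sum[OF assms(2), of "q * m" "q * n"], of "of_nat :: nat \<Rightarrow> rat"]
    by (simp add: c_def w_def)
  then have T: "g * (\<Sum>k<q. of_nat ((q * m + 2 * k) choose (q * n + k + d)))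
      = (\<Sum>t\<in>{0<..<q}. g * c (- int t) * w (int d + int t)) + g * c 0 * w (int d)
        + (\<Sum>t\<in>{0<..<q}. g * c (int t) * w (int d - int t)) + g * c (int q) * w (int d - int q)
        + (\<Sum>t\<in>{0<..<q}. g * c (int q + int t) * w (int d - (int q + int t)))"
    by (simp add: sum_int_interval_split[OF q_pos] sum_distrib_left algebra_simps)

  have lower: "pd 2 (g * c (- int t) - of_nat (n + 1) * of_nat n * alt_frac t)" if "0 < t" "t < q" for t
    using pd_mult_left[OF pd_0_of_nat[of "n + 1"] choose_ratio_lower[OF assms(1) that]]
    by (simp add: g_def c_def b_def algebra_simps)
  have ct: "c (int t) = of_nat ((q * m) choose (q * n + t))" for t
    unfolding c_def by (subst ichoose_of_nat[symmetric]) simp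
  have mid: "pd 2 (g * c (int t) - of_nat (n + 1) * x * alt_frac t)" if "0 < t" "t < q" for t
    using pd_mult_left[OF pd_0_of_nat[of "n + 1"] choose_ratio_cong[OF assms(1) that]]
    unfolding ct by (simp add: g_def b_def x_def algebra_simps)
  have c0: "g * c 0 = of_nat (n + 1) * choose_quot m n"
    by (simp add: g_def c_def b_def choose_quot_def flip: of_nat_mult)
  \<comment> \<open>Absorption allows normalizing by \<open>m choose (n + 1)\<close> near
    \<open>s = q\<close>, so that the ratio lemmas apply with \<open>n + 1\<close>. For
    \<open>m = n\<close> the contributions there are zero.\<close>
  have g: "g = x / of_nat (m choose (n + 1))" if "n < m"
    using choose_Suc_mult[of m n] that b by (simp add: g_def b_def x_def field_simps)
  have cq: "c (int q + int t) = of_nat ((q * m) choose (q * (n + 1) + t))" for t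
    unfolding c_def by (subst ichoose_of_nat[symmetric]) (simp add: algebra_simps)
  have c1: "g * c (int q) = x * choose_quot m (n + 1)"
  proof (cases "n < m")
    case True
    then show ?thesis using cq[of 0] by (simp add: g choose_quot_def)
  next
    case False
    then show ?thesis using cq[of 0] assms(1) q_pos by (simp add: x_def binomial_eq_0)
  qed
  have upper: "pd 2 (g * c (int q + int t) - x * (x - 1) * alt_frac t)" if "0 < t" "t < q" for t
  proof (cases "n < m")
    case True
    then have "n + 1 \<le> m" by simp
    from pd_mult_left[OF x choose_ratio_cong[OF this that]] show ?thesis
      unfolding g[OF True] cq by (simp add: x_def algebra_simps)
  next
    case False
    then show ?thesis using cq[of t] assms(1) that by (simp add: x_def binomial_eq_0)
  qed

  have s1: "pd 2 ((\<Sum>t\<in>{0<..<q}. g * c (- int t) * w (int d + int t)) - of_nat (n + 1) * of_nat n * E)"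
    unfolding E_def w_def weighted_cut_leg_sums(1)[OF assms(2), symmetric]
    by (intro weighted_sum_cong lower pd_mult_left pd_0_of_nat)
  have s3: "pd 2 ((\<Sum>t\<in>{0<..<q}. g * c (int t) * w (int d - int t)) - of_nat (n + 1) * x * reflected_sum d)"
    unfolding w_def weighted_cut_leg_sums(2)[OF assms(2), symmetric]
    by (intro weighted_sum_cong mid pd_mult_left pd_0_of_nat x)
  have s5: "pd 2 ((\<Sum>t\<in>{0<..<q}. g * c (int q + int t) * w (int d - (int q + int t))) - x * (x - 1) * D)"
    unfolding D_def w_def weighted_cut_leg_sums(3)[OF assms(2), symmetric]
    by (intro weighted_sum_cong upper pd_mult_left pd_diff pd_0_1 x)
  have s2: "pd 2 (g * c 0 * w (int d) - of_nat (n + 1) * (leg3 (int q - int d) + 2 * E))"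
  proof -
    have "g * c 0 * w (int d) - of_nat (n + 1) * (leg3 (int q - int d) + 2 * E)
        = of_nat (n + 1) * (choose_quot m n - 1) * w (int d) + of_nat (n + 1) * (w (int d) - (leg3 (int q - int d) + 2 * E))"
      unfolding c0 by (simp add: algebra_simps)
    then show ?thesis
      using pd_add[OF pd_mult_right[OF choose_quot_near[OF assms(1)] w] pd_mult_left[OF pd_0_of_nat[of "n + 1"] central_sum_cong[OF assms(2)]]]
      unfolding w_def E_def by simp
  qed
  have s4: "pd 2 (g * c (int q) * w (int d - int q) - x * (leg3 (int d) + 2 * D))"
  proof -
    have "w (int d - int q) = w (int (q - d))"
      using central_sum_minus[of q "int d - int q"] assms(2) by (simp add: w_def of_nat_diff)
    then have W: "pd 2 (w (int d - int q) - (leg3 (int d) + 2 * D))"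
      using central_sum_cong[of "q - d"] assms(2) by (simp add: w_def D_def of_nat_diff)
    have U: "pd 2 (x * (choose_quot m (n + 1) - 1))"
      using choose_quot_near_Suc[of n m] assms(1) unfolding x_def by (cases "n = m") auto
    have "g * c (int q) * w (int d - int q) - x * (leg3 (int d) + 2 * D)
        = x * (choose_quot m (n + 1) - 1) * w (int d - int q) + x * (w (int d - int q) - (leg3 (int d) + 2 * D))"
      unfolding c1 by (simp add: algebra_simps)
    then show ?thesis
      using pd_add[OF pd_mult_right[OF U w] pd_mult_left[OF x W]] by simp
  qed
  \<comment> \<open>Stated for arbitrary summands, to serve as a rewrite rule:
    \<open>n * (n + 1) + 2 * (n + 1)\<close> is the coefficient of \<open>E\<close>, and
    \<open>x * (x - 1) + 2 * x\<close> that of \<open>D\<close>.\<close>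
  have eq: "s1 + s2 + s3 + s4 + s5
      - (of_nat (n + 1) * leg3 (int q - int d) + x * leg3 (int d)
        + of_nat ((n + 1) * (n + 2)) * E + x * (x + 1) * D + of_nat (n + 1) * x * reflected_sum d)
    = (s1 - of_nat (n + 1) * of_nat n * E) + (s2 - of_nat (n + 1) * (leg3 (int q - int d) + 2 * E))
      + (s3 - of_nat (n + 1) * x * reflected_sum d) + (s4 - x * (leg3 (int d) + 2 * D)) + (s5 - x * (x - 1) * D)"
    for s1 s2 s3 s4 s5
    by (simp add: algebra_simps)
  show ?thesis
    unfolding b_def[symmetric] g_def[symmetric] T eq by (intro pd_add s1 s2 s3 s4 s5)
qed

section \<open>Reduction of all sums to \<open>S d\<close>\<close>

text \<open>Replace \<open>alt_frac k\<close> by \<open>q choose k\<close>; the closed form of the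
  full sum minus its terms at 0 and \<open>q\<close> remains.\<close>

lemma sum_alt_frac_leg:
  "pd 2 ((\<Sum>k\<in>{0<..<q}. alt_frac k * leg3 (x - int k)) - ((- 1) ^ q * leg3 (x + int q) - leg3 x - leg3 (x - int q)))"
proof -
  have "{..q} = insert 0 (insert q {0<..<q})" by auto
  then have "(\<Sum>k\<in>{0<..<q}. int (q choose k) * Legendre (x - int k) 3)
      = (- 1) ^ q * Legendre (x + int q) 3 - Legendre x 3 - Legendre (x - int q) 3"
    using sum_choose_Legendre_3[of q x] q_pos by simp
  from arg_cong[OF this, of "of_int :: int \<Rightarrow> rat"]
  have "(\<Sum>k\<in>{0<..<q}. of_nat (q choose k) * leg3 (x - int k))
      = (- 1) ^ q * leg3 (x + int q) - leg3 x - leg3 (x - int q)" by simp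
  moreover have "pd 2 ((\<Sum>k\<in>{0<..<q}. alt_frac k * leg3 (x - int k)) - (\<Sum>k\<in>{0<..<q}. of_nat (q choose k) * leg3 (x - int k)))"
    unfolding sum_subtractf[symmetric] left_diff_distrib[symmetric]
    by (intro pd_sum pd_mult_right pd_diff_commute[OF choose_q_cong] pd_0_of_int) auto
  ultimately show ?thesis by simp
qed

lemma alt_frac_reflect: "0 < k \<Longrightarrow> k < q \<Longrightarrow> pd 2 (alt_frac (q - k) - alt_frac k)"
  using pd_diff[OF choose_q_cong[of k] choose_q_cong[of "q - k"]] binomial_symmetric[of k q] by simp

text \<open>Reversing \<open>S (q - d)\<close> gives minus the range \<open>d < k < q\<close> of the
  full sum at \<open>d\<close>, whose range \<open>k < d\<close> is \<open>q * S d\<close>; the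
  symbol vanishes at \<open>k = d\<close>.\<close>

lemma S_reflect:
  assumes "d \<le> q"
  shows "pd 2 (of_nat q * S d - of_nat q * S (q - d)
    - ((- 1) ^ q * leg3 (int d + int q) - leg3 (int d) - leg3 (int d - int q)))"
proof -
  have "of_nat q * S (q - d) = (\<Sum>k\<in>{d<..<q}. alt_frac (q - k) * leg3 (int k - int d))"
    unfolding q_times_S
    by (rule sum.reindex_bij_witness[of _ "\<lambda>k. q - k" "\<lambda>k. q - k"]) (use assms in \<open>auto simp: of_nat_diff algebra_simps\<close>)
  moreover have "pd 2 ((\<Sum>k\<in>{d<..<q}. alt_frac (q - k) * leg3 (int k - int d)) - (\<Sum>k\<in>{d<..<q}. alt_frac k * leg3 (int k - int d)))"
    unfolding sum_subtractf[symmetric] left_diff_distrib[symmetric]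
    by (intro pd_sum pd_mult_right alt_frac_reflect pd_0_of_int) auto
  moreover have "(\<Sum>k\<in>{d<..<q}. alt_frac k * leg3 (int k - int d)) = - (\<Sum>k\<in>{d<..<q}. alt_frac k * leg3 (int d - int k))"
    unfolding sum_negf[symmetric] using Legendre_3_minus[of "int d - int _"] by (intro sum.cong) auto
  ultimately have E: "pd 2 (of_nat q * S (q - d) + (\<Sum>k\<in>{d<..<q}. alt_frac k * leg3 (int d - int k)))"
    by simp
  have "(\<Sum>k\<in>{0<..<q}. alt_frac k * leg3 (int d - int k))
      = (\<Sum>k\<in>{0<..<d} \<union> {d<..<q}. alt_frac k * leg3 (int d - int k))"
    by (rule sum.mono_neutral_right) (use assms in \<open>auto simp: Legendre_3_eq not_less\<close>)
  also have "\<dots> = of_nat q * S d + (\<Sum>k\<in>{d<..<q}. alt_frac k * leg3 (int d - int k))"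
    unfolding q_times_S by (rule sum.union_disjoint) auto
  finally show ?thesis
    using pd_diff[OF sum_alt_frac_leg[of "int d"] E] by (simp add: algebra_simps)
qed

lemma three_dvd_q_iff: "3 dvd int q \<longleftrightarrow> p = 3"
proof -
  have "3 dvd int q \<longleftrightarrow> 3 dvd q" by presburger
  also have "\<dots> \<longleftrightarrow> 3 dvd p"
    using a_pos by (auto simp: q_def intro: prime_dvd_power dvd_power_le)
  also have "\<dots> \<longleftrightarrow> p = 3"
    using prime_p by (auto simp: prime_nat_iff)
  finally show ?thesis .
qed

text \<open>Compare termwise with the full sum at \<open>d + q\<close>. For \<open>k \<ge> d\<close>
  the symbols agree. For \<open>k < d\<close> the discrepancy is a sum over shifts by
  \<open>q\<close>, which vanishes unless \<open>p = 3\<close>; then it is a multiple of 3, and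
  \<open>alt_frac k\<close> supplies the second 3.\<close>

lemma reflected_sum_cong:
  assumes "d \<le> q"
  shows "pd 2 (reflected_sum d - of_nat q * S d
    - ((- 1) ^ q * leg3 (int d + 2 * int q) - leg3 (int d + int q) - leg3 (int d)))"
proof -
  have "of_nat q * S d = (\<Sum>k\<in>{0<..<q}. alt_frac k * (if k < d then leg3 (int d - int k) else 0))"
    unfolding q_times_S by (rule sum.mono_neutral_cong_left) (use assms in auto)
  then have "reflected_sum d - of_nat q * S d - (\<Sum>k\<in>{0<..<q}. alt_frac k * leg3 (int d + int q - int k))
      = (\<Sum>k\<in>{0<..<q}. alt_frac k * (leg3 (int q - \<bar>int d - int k\<bar>)
          - (if k < d then leg3 (int d - int k) else 0) - leg3 (int d + int q - int k)))"
    unfolding reflected_sum_def by (simp only: sum_subtractf right_diff_distrib)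
  also have "pd 2 \<dots>"
  proof (rule pd_sum)
    fix k assume k: "k \<in> {0<..<q}"
    show "pd 2 (alt_frac k * (leg3 (int q - \<bar>int d - int k\<bar>)
          - (if k < d then leg3 (int d - int k) else 0) - leg3 (int d + int q - int k)))"
    proof (cases "k < d")
      case True
      define y where "y = int d - int k"
      have "Legendre (int q - y) 3 - Legendre y 3 - Legendre (y + int q) 3 = - (of_bool (p = 3) * 3 * Legendre y 3)"
        using Legendre_3_sum_shift[of y "int q"] Legendre_3_minus[of "y - int q"] three_dvd_q_iff by simp
      from arg_cong[OF this, of "of_int :: int \<Rightarrow> rat"]
      have eq: "leg3 (int q - y) - leg3 y - leg3 (y + int q) = of_int (- (of_bool (p = 3) * 3 * Legendre y 3))"
        by simp
      have "leg3 (int q - \<bar>int d - int k\<bar>) - leg3 (int d - int k) - leg3 (int d + int q - int k)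
          = of_int (- (of_bool (p = 3) * 3 * Legendre y 3))"
      proof -
        have "\<bar>y\<bar> = y" "int d - int k = y" "int d + int q - int k = y + int q"
          using True by (auto simp: y_def)
        then show ?thesis using eq by (simp only:)
      qed
      moreover have "pd 1 (of_int (- (of_bool (p = 3) * 3 * Legendre y 3)))"
        by (rule pd_of_int) auto
      then have "pd 2 (alt_frac k * of_int (- (of_bool (p = 3) * 3 * Legendre y 3)))"
        using k by (intro pd_mult_1_1 pd_alt_frac) auto
      ultimately show ?thesis using True by (simp only: if_True)
    qed (simp add: algebra_simps)
  qed
  finally show ?thesis
    using sum_alt_frac_leg[of "int d + int q"] by (auto dest: pd_add simp: algebra_simps)
qed

text \<open>Here \<open>s\<close> is the closed form of the full sums. For odd \<open>p\<close> it
  is minus a sum over shifts by \<open>q\<close>, so it vanishes unless \<open>p = 3\<close>; for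
  \<open>p = 2\<close> it is twice one symbol, and only parity is left to check.\<close>

lemma pd_2_correction:
  fixes m n d :: nat
  assumes "n \<le> m"
  defines "s x \<equiv> (- 1) ^ q * Legendre (x + int q) 3 - Legendre x 3 - Legendre (x - int q) 3"
  shows "int p ^ 2 dvd int (n + 1) * (int m - int n) * s (int d + int q) - int ((n + 1) * (n + 2)) * s (int d)
    + of_bool (p = 3) * Legendre (int d) 3 * int (p * (n + 1) * (m + n + 1))
    - of_bool (p = 2 \<and> \<not> 3 dvd int d - (- 1) ^ a) * int (p * m * (n + 1))"
proof (cases "p = 2")
  case False
  then have "odd q" using prime_p by (auto simp: q_def prime_nat_iff dest!: prime_dvd_power[OF two_is_prime_nat])
  then have s: "s x = - (of_bool (p = 3) * 3 * Legendre x 3)" for x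
    using Legendre_3_sum_shift[of x "int q"] three_dvd_q_iff unfolding s_def by simp
  show ?thesis
  proof (cases "p = 3")
    case True
    then obtain k where "int q = 3 * k" using three_dvd_q_iff by (auto elim: dvdE)
    then have "s (int d + int q) = s (int d)"
      unfolding s using Legendre_3_add_multiple[of "int d" k] by simp
    moreover have "int (n + 1) * (int m - int n) * - (3 * l) - int ((n + 1) * (n + 2)) * - (3 * l)
        + l * int (3 * (n + 1) * (m + n + 1)) = 9 * (l * (int n + 1) ^ 2)" for l
      by (simp add: algebra_simps power2_eq_square)
    ultimately show ?thesis using True by (simp add: s)
  qed (use False in \<open>simp add: s\<close>)
next
  case True
  have "even q" using a_pos unfolding q_def unfolding True by simp
  \<comment> \<open>As \<open>2\<close> is \<open>-1\<close> modulo 3, \<open>q\<close> may replace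
    \<open>(- 1) ^ a\<close> in the condition on \<open>d\<close>.\<close>
  obtain k where k: "int q - (- 1) ^ a = 3 * k"
  proof -
    have "[(2::int) = - 1] (mod 3)" by (simp add: cong_def)
    then have "[2 ^ a = (- 1 :: int) ^ a] (mod 3)" by (rule cong_pow)
    moreover have "int q = 2 ^ a" unfolding q_def unfolding True by simp
    ultimately have "3 dvd int q - (- 1) ^ a" by (simp add: cong_iff_dvd_diff)
    then show ?thesis using that by (auto elim: dvdE)
  qed
  define L where "L = Legendre (int d - int q) 3"
  have L_range: "L \<in> {0, 1, -1}" using Legendre_3_unique L_def by blast
  have nd: "\<not> 3 dvd int q" using three_dvd_q_iff True by simp
  have s1: "s (int d) = 2 * Legendre (int d + int q) 3"
    using Legendre_3_sum_shift[of "int d" "int q"] nd \<open>even q\<close> unfolding s_def by simp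
  have "Legendre (int d + int q + int q) 3 = L"
    unfolding L_def using Legendre_3_add_multiple[of "int d - int q" "int q"] by (simp add: algebra_simps)
  then have s2: "s (int d + int q) = 2 * L"
    using Legendre_3_sum_shift[of "int d + int q" "int q"] nd \<open>even q\<close> unfolding s_def by simp
  have "3 dvd int d - (- 1) ^ a \<longleftrightarrow> 3 dvd int d - int q"
  proof -
    have "int d - (- 1) ^ a = (int d - int q) + 3 * k" using k by simp
    then show ?thesis by (simp only: dvd_add_left_iff dvd_triv_left)
  qed
  also have "\<dots> \<longleftrightarrow> L = 0"
    unfolding L_def Legendre_3_eq by presburger
  finally have L: "(\<not> 3 dvd int d - (- 1) ^ a) \<longleftrightarrow> L \<noteq> 0" by simp
  let ?b = "of_bool (L \<noteq> 0) :: int"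
  \<comment> \<open>If \<open>L\<close> is non-zero, its term and the last one combine modulo 2 to
    \<open>n * (n + 1)\<close>; both this and \<open>(n + 1) * (n + 2)\<close> are even.\<close>
  have "even (int (n + 1) * (int m - int n) * L - int ((n + 1) * (n + 2)) * Legendre (int d + int q) 3
      - ?b * int (m * (n + 1)))"
    using L_range by auto
  then have "2 * 2 dvd 2 * (int (n + 1) * (int m - int n) * L - int ((n + 1) * (n + 2)) * Legendre (int d + int q) 3
      - ?b * int (m * (n + 1)))" by (rule mult_dvd_mono[OF dvd_refl])
  then show ?thesis
    unfolding L s1 s2 using True by (simp add: algebra_simps)
qed

lemma normalized_sum_cong_S:
  fixes m n d :: nat
  assumes "n \<le> m" and "d \<le> q"
  shows "pd 2
    (of_nat (n + 1) / of_nat (m choose n) * (\<Sum>k<q. of_nat ((q * m + 2 * k) choose (q * n + k + d)))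
      - of_nat (n + 1) * leg3 (int q - int d) - (of_nat m - of_nat n) * leg3 (int d)
    - (((of_nat m - of_nat n)\<^sup>2 + of_nat ((m + 1) * (n + 2))) * of_nat q * S d
      - of_bool (p = 3) * leg3 (int d) * of_nat (p * (n + 1) * (m + n + 1))
      + of_bool (p = 2 \<and> \<not> 3 dvd int d - (- 1) ^ a) * of_nat (p * m * (n + 1))))"
proof -
  define x where "x = (of_nat m - of_nat n :: rat)"
  define D where "D = of_nat q * S d"
  define E where "E = of_nat q * S (q - d)"
  define T where "T = of_nat (n + 1) / of_nat (m choose n) * (\<Sum>k<q. of_nat ((q * m + 2 * k) choose (q * n + k + d)) :: rat)"
  define s where "s x = (- 1) ^ q * Legendre (x + int q) 3 - Legendre x 3 - Legendre (x - int q) 3" for x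
  define t3 where "t3 = of_bool (p = 3) * Legendre (int d) 3 * int (p * (n + 1) * (m + n + 1))"
  define t2 where "t2 = of_bool (p = 2 \<and> \<not> 3 dvd int d - (- 1) ^ a) * int (p * m * (n + 1))"
  define l1 where "l1 = leg3 (int q - int d)"
  define l2 where "l2 = leg3 (int d)"
  have 1: "pd 2 (T - (of_nat (n + 1) * l1 + x * l2
      + of_nat ((n + 1) * (n + 2)) * E + x * (x + 1) * D + of_nat (n + 1) * x * reflected_sum d))"
    unfolding T_def l1_def l2_def x_def D_def E_def by (rule normalized_sum_cong[OF assms])
  have 2: "pd 2 (D - E - of_int (s (int d)))"
    using S_reflect[OF assms(2)] unfolding D_def E_def s_def by simp
  have 3: "pd 2 (reflected_sum d - D - of_int (s (int d + int q)))"
    using reflected_sum_cong[OF assms(2)] unfolding D_def s_def by (simp add: algebra_simps)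
  have 4: "pd 2 (of_int (int (n + 1) * (int m - int n) * s (int d + int q) - int ((n + 1) * (n + 2)) * s (int d) + t3 - t2))"
    unfolding s_def t2_def t3_def by (rule pd_of_int, rule pd_2_correction) (rule assms)
  have x: "pd 0 (of_nat (n + 1) * x)" unfolding x_def by (intro pd_mult_left pd_0_of_nat pd_0_of_int_diff)
  \<comment> \<open>This combination eliminates \<open>E\<close>, \<open>reflected_sum\<close> and
    \<open>s\<close>. The coefficient of \<open>D\<close> becomes
    \<open>x ^ 2 + (n + 2) * (n + 1 + x)\<close>, and \<open>n + 1 + x = m + 1\<close>.\<close>
  have "pd 2 (T - (of_nat (n + 1) * l1 + x * l2
        + of_nat ((n + 1) * (n + 2)) * E + x * (x + 1) * D + of_nat (n + 1) * x * reflected_sum d)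
      - of_nat ((n + 1) * (n + 2)) * (D - E - of_int (s (int d)))
      + of_nat (n + 1) * x * (reflected_sum d - D - of_int (s (int d + int q)))
      + of_int (int (n + 1) * (int m - int n) * s (int d + int q) - int ((n + 1) * (n + 2)) * s (int d) + t3 - t2))"
    by (intro pd_add pd_diff pd_mult_left 1 2 3 4 x pd_0_of_nat)
  also have "T - (of_nat (n + 1) * l1 + x * l2
        + of_nat ((n + 1) * (n + 2)) * E + x * (x + 1) * D + of_nat (n + 1) * x * reflected_sum d)
      - of_nat ((n + 1) * (n + 2)) * (D - E - of_int (s (int d)))
      + of_nat (n + 1) * x * (reflected_sum d - D - of_int (s (int d + int q)))
      + of_int (int (n + 1) * (int m - int n) * s (int d + int q) - int ((n + 1) * (n + 2)) * s (int d) + t3 - t2)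
    = T - of_nat (n + 1) * l1 - x * l2 - ((x\<^sup>2 + of_nat ((m + 1) * (n + 2))) * D - of_int t3 + of_int t2)"
    by (simp add: x_def algebra_simps power2_eq_square)
  finally have "pd 2 (T - of_nat (n + 1) * l1 - x * l2 - ((x\<^sup>2 + of_nat ((m + 1) * (n + 2))) * D - of_int t3 + of_int t2))" .
  then show ?thesis
    unfolding T_def l1_def l2_def t2_def t3_def x_def D_def
    by (simp only: of_int_mult of_int_of_nat_eq of_int_of_bool mult.assoc)
qed

end

section \<open>The general congruence and its Catalan case\<close>

theorem theorem1p2:
  fixes p a d :: nat
  assumes "prime p" and "a > 0" and "d \<in> {0..p ^ a}"
  shows "(\<forall>m n :: nat. m \<ge> n \<longrightarrow>
      rat_cong p 2
        (of_nat (n + 1) / of_nat (m choose n)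
            * (\<Sum>k = 0..p ^ a - 1. of_nat ((p ^ a * m + 2 * k) choose (p ^ a * n + k + d)))
          - of_nat (n + 1) * leg3 (int (p ^ a) - int d)
          - (of_nat m - of_nat n) * leg3 (int d))
        (((of_nat m - of_nat n)\<^sup>2 + of_nat ((m + 1) * (n + 2))) * of_nat (p ^ a) * S d
          - of_bool (p = 3) * leg3 (int d) * of_nat (p * (n + 1) * (m + n + 1))
          + of_bool (p = 2 \<and> \<not> 3 dvd int d - (- 1) ^ a) * of_nat (p * m * (n + 1))))
    \<and> (\<forall>n :: nat.
      rat_cong p 2
        (1 / catalan n
            * (\<Sum>k = 0..p ^ a - 1. of_nat ((2 * p ^ a * n + 2 * k) choose (p ^ a * n + k + d)))
          - of_nat n * leg3 (int d)
          - of_nat (n + 1) * leg3 (int (p ^ a) - int d))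
        (of_nat (p ^ a * (n + 1) * (3 * n + 2)) * S d
          - of_bool (p = 3) * of_nat (p * (n + 1)) * leg3 (int d)))"
proof -
  interpret prime_power p a
    using assms(1,2) by unfold_locales
  have range: "{0..q - 1} = {..<q}" using q_pos by auto
  have d: "d \<le> q" using assms(3) by (simp add: q_def)
  \<comment> \<open>The case \<open>m = 2 * n\<close>, where
    \<open>n ^ 2 + (2 * n + 1) * (n + 2) = (n + 1) * (3 * n + 2)\<close>.\<close>
  have catalan: "rat_cong p 2
        (1 / catalan n * (\<Sum>k<q. of_nat ((2 * q * n + 2 * k) choose (q * n + k + d)))
          - of_nat n * leg3 (int d) - of_nat (n + 1) * leg3 (int q - int d))
        (of_nat (q * (n + 1) * (3 * n + 2)) * S d
          - of_bool (p = 3) * of_nat (p * (n + 1)) * leg3 (int d))" for n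
  proof -
    define b3 where "b3 = (of_bool (p = 3) :: int)"
    define b2 where "b2 = (of_bool (p = 2 \<and> \<not> 3 dvd int d - (- 1) ^ a) :: int)"
    define l where "l = Legendre (int d) 3"
    let ?L = "1 / catalan n * (\<Sum>k<q. of_nat ((2 * q * n + 2 * k) choose (q * n + k + d)))
          - of_nat n * leg3 (int d) - of_nat (n + 1) * leg3 (int q - int d)"
    let ?Y = "of_nat (q * (n + 1) * (3 * n + 2)) * S d"
    have "n \<le> 2 * n" by simp
    from normalized_sum_cong_S[OF this d]
    have "pd 2 (?L - (?Y - of_int (b3 * l * int (p * (n + 1) * (3 * n + 1))) + of_int (b2 * int (p * (2 * n) * (n + 1)))))"
      unfolding b3_def b2_def l_def catalan_def
      by (simp add: algebra_simps power2_eq_square)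
    \<comment> \<open>The correction for \<open>p = 2\<close> is now a multiple of 4, and for
      \<open>p = 3\<close> replacing the factor \<open>3 * n + 1\<close> by 1 costs a multiple of
      9.\<close>
    moreover have "pd 2 (of_int (b2 * int (p * (2 * n) * (n + 1)) - b3 * l * int (3 * p * n * (n + 1))))"
    proof (rule pd_of_int)
      consider "p = 2" | "p = 3" | "b2 = 0" "b3 = 0" by (auto simp: b2_def b3_def)
      then show "int p ^ 2 dvd b2 * int (p * (2 * n) * (n + 1)) - b3 * l * int (3 * p * n * (n + 1))"
        by cases (auto simp: b2_def b3_def power2_eq_square)
    qed
    ultimately have "pd 2 (?L - (?Y - of_int (b3 * l * int (p * (n + 1) * (3 * n + 1))) + of_int (b2 * int (p * (2 * n) * (n + 1))))
      + of_int (b2 * int (p * (2 * n) * (n + 1)) - b3 * l * int (3 * p * n * (n + 1))))"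
      by (rule pd_add)
    also have "?L - (?Y - of_int (b3 * l * int (p * (n + 1) * (3 * n + 1))) + of_int (b2 * int (p * (2 * n) * (n + 1))))
      + of_int (b2 * int (p * (2 * n) * (n + 1)) - b3 * l * int (3 * p * n * (n + 1)))
      = ?L - (?Y - of_int b3 * of_nat (p * (n + 1)) * of_int l)"
      by (simp add: algebra_simps)
    finally show ?thesis
      unfolding b3_def l_def by (intro rat_cong_if_pd) simp
  qed
  show ?thesis
    unfolding q_def[symmetric] range
    using rat_cong_if_pd[OF normalized_sum_cong_S[OF _ d]] catalan by blast
qed

end
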